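(* Let $(G,\rho)$ be an infinite bounded degree rooted graph, and let $(G_n)_{n\ge 1}$ be a sequence of finite graphs with uniform Cheeger constant $h>0$ (that is, every $G_n$ has Cheeger constant at least $h$) and a uniform degree bound $d$ (that is, all degrees in every $G_n$ are at most $d$), such that $G_n \to (G,\rho)$ weakly. Let $p\in[0,1]$ and write $G_n(p)$ for the graph of open edges obtained from $G_n$ by performing bond percolation with parameter $p$. (i) If $p<p_c(G)$, then for any constant $\alpha>0$, $$ \mathbf{P} \big( G_n(p) \text{ contains a component of size at least } \alpha|G_n| \big) \to 0 \quad \text{as } n\to\infty .$$ (ii) If $p>p_c(G)$, then there exists some $\alpha>0$ such that $$ \mathbf{P} \big( G_n(p) \text{ contains a component of size at least } \alpha|G_n| \big) \to 1 \quad \text{as } n\to\infty .$$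
   Context: Bond percolation with parameter $p$ on a graph: each edge is kept (open) independently with probability $p$ and otherwise removed (closed). For an infinite graph $G$, $$p_c(G) = \inf \{ p \in [0,1] : \mathbf{P}_p ( \exists \text{ an infinite component} ) >0 \},$$ where components are those of the graph of open edges. $|G_n|$ is the number of vertices of $G_n$, and the size of a component is its number of vertices. For a vertex $v$ of a graph $G$, $B_G(v,R)$ is the ball of radius $R$ centered at $v$ in the graph metric, with its induced graph structure and root $v$. Weak convergence: let $U_n$ be a uniformly chosen random vertex of the finite graph $G_n$. The sequence $\{G_n\}$ converges weakly to the infinite rooted graph $(G,\rho)$ (where $\rho$ is a fixed vertex of $G$) if for each $R>0$ the probability that $B_{G_n}(U_n,R)$ and $B_G(\rho,R)$ are not isomorphic as rooted graphs tends to $0$ as $n\to\infty$. Cheeger constant: for a finite graph $G=(V,E)$, $$ h(G) = \min_{A\subset V} \left\{ \frac{|E(A,V\setminus A)|}{|A|} : 0<|A|\le |V|/2 \right\},$$ where $E(A,B)$ is the set of edges with one endpoint in $A$ and the other in $B$.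
   Formalization: The limit graph G is assumed connected; otherwise the claim fails, e.g. G the disjoint union of a single edge containing ρ and an infinite path, with every G_n a single edge, violates (i). *)

theory Defs
  imports "HOL-Probability.Probability"
begin

record 'a ugraph =
  verts :: "'a set"
  edges :: "'a set set"

definition simple_graph :: "'a ugraph \<Rightarrow> bool" where
  "simple_graph G \<longleftrightarrow>
     (\<forall>e\<in>edges G. \<exists>u\<in>verts G. \<exists>v\<in>verts G. u \<noteq> v \<and> e = {u, v})"

definition finite_graph :: "'a ugraph \<Rightarrow> bool" where
  "finite_graph G \<longleftrightarrow> simple_graph G \<and> finite (verts G) \<and> verts G \<noteq> {}"

definition adj :: "'a ugraph \<Rightarrow> 'a rel" where
  "adj G = {(u, v). {u, v} \<in> edges G}"

definition connected_graph :: "'a ugraph \<Rightarrow> bool" where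
  "connected_graph G \<longleftrightarrow> (\<forall>u\<in>verts G. \<forall>v\<in>verts G. (u, v) \<in> (adj G)\<^sup>*)"

definition degree_bound :: "'a ugraph \<Rightarrow> nat \<Rightarrow> bool" where
  "degree_bound G d \<longleftrightarrow>
     (\<forall>v\<in>verts G. finite {e \<in> edges G. v \<in> e} \<and> card {e \<in> edges G. v \<in> e} \<le> d)"

text \<open>The graph metric is the least length of a walk; it is infinite if there is no walk.\<close>

definition graph_dist :: "'a ugraph \<Rightarrow> 'a \<Rightarrow> 'a \<Rightarrow> enat" where
  "graph_dist G u v = (INF k\<in>{k. (u, v) \<in> adj G ^^ k}. enat k)"

definition induced :: "'a ugraph \<Rightarrow> 'a set \<Rightarrow> 'a ugraph" where
  "induced G S = \<lparr>verts = verts G \<inter> S, edges = {e \<in> edges G. e \<subseteq> S}\<rparr>"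

definition graph_ball :: "'a ugraph \<Rightarrow> 'a \<Rightarrow> nat \<Rightarrow> 'a ugraph" where
  "graph_ball G v R = induced G {u \<in> verts G. graph_dist G v u \<le> enat R}"

definition rooted_iso :: "'a ugraph \<Rightarrow> 'a \<Rightarrow> 'b ugraph \<Rightarrow> 'b \<Rightarrow> bool" where
  "rooted_iso G r H s \<longleftrightarrow>
     (\<exists>f. bij_betw f (verts G) (verts H) \<and> f r = s \<and>
        (\<forall>u\<in>verts G. \<forall>v\<in>verts G. {u, v} \<in> edges G \<longleftrightarrow> {f u, f v} \<in> edges H))"

definition weakly_converges :: "(nat \<Rightarrow> 'b ugraph) \<Rightarrow> 'a ugraph \<Rightarrow> 'a \<Rightarrow> bool" where
  "weakly_converges Gs G \<rho> \<longleftrightarrow>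
     (\<forall>R>0. (\<lambda>n. \<P>(u in measure_pmf (pmf_of_set (verts (Gs n))).
          \<not> rooted_iso (graph_ball (Gs n) u R) u (graph_ball G \<rho> R) \<rho>)) \<longlonglongrightarrow> 0)"

definition edges_between :: "'a ugraph \<Rightarrow> 'a set \<Rightarrow> 'a set \<Rightarrow> 'a set set" where
  "edges_between G A B = {e \<in> edges G. \<exists>u\<in>A. \<exists>v\<in>B. e = {u, v}}"

text \<open>For a finite graph with at least two vertices the infimum is a minimum over a finite
  nonempty family. It is taken in the extended reals so that the one-vertex graph, which has no
  admissible \<open>A\<close>, gets the value \<open>\<infinity>\<close>.\<close>

definition cheeger :: "'a ugraph \<Rightarrow> ereal" where
  "cheeger G = (INF A\<in>{A. A \<subseteq> verts G \<and> 0 < card A \<and> real (card A) \<le> real (card (verts G)) / 2}.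
     ereal (real (card (edges_between G A (verts G - A))) / real (card A)))"

text \<open>A configuration assigns \<open>True\<close> to the open edges.\<close>

definition percolation :: "'a ugraph \<Rightarrow> real \<Rightarrow> ('a set \<Rightarrow> bool) measure" where
  "percolation G p = (\<Pi>\<^sub>M e\<in>edges G. measure_pmf (bernoulli_pmf p))"

definition open_graph :: "'a ugraph \<Rightarrow> ('a set \<Rightarrow> bool) \<Rightarrow> 'a ugraph" where
  "open_graph G \<omega> = \<lparr>verts = verts G, edges = {e \<in> edges G. \<omega> e}\<rparr>"

definition components_of :: "'a ugraph \<Rightarrow> 'a set set" where
  "components_of H = (\<lambda>v. {u \<in> verts H. (v, u) \<in> (adj H)\<^sup>*}) ` verts H"

text \<open>If \<open>G\<close> is infinite and connected, the set below contains \<open>1\<close>, so the infimum is genuine.\<close>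

definition p_crit :: "'a ugraph \<Rightarrow> real" where
  "p_crit G = Inf {p \<in> {0..1}.
     \<P>(\<omega> in percolation G p. \<exists>C\<in>components_of (open_graph G \<omega>). infinite C) > 0}"

definition prob_large_component :: "'a ugraph \<Rightarrow> real \<Rightarrow> real \<Rightarrow> real" where
  "prob_large_component G p \<alpha> =
     \<P>(\<omega> in percolation G p.
        \<exists>C\<in>components_of (open_graph G \<omega>). real (card C) \<ge> \<alpha> * real (card (verts G)))"

end

theory Submission imports Defs begin

text \<open>
  Both halves rest on one locality principle. In a graph of bounded degree, the open cluster of \<open>v\<close>
  has at least \<open>k\<close> vertices if and only if at least \<open>k\<close> vertices can be reached from \<open>v\<close> by open walks of
  length at most \<open>k\<close> (\<open>big_iff_cluster\<close>): as long as the walk balls keep growing, each step adds a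
  vertex. The probability \<open>theta E p k v\<close> of this event therefore depends only on the rooted
  isomorphism class of the ball of radius \<open>k\<close> about \<open>v\<close> (\<open>theta_rooted_iso\<close>), and by weak convergence
  all but \<open>o(|G\<^sub>n|)\<close> vertices of \<open>G\<^sub>n\<close> have the same value of it as \<open>\<rho>\<close> has in \<open>G\<close>. As \<open>k\<close> grows, the
  value at \<open>\<rho>\<close> decreases to the probability that \<open>\<rho>\<close> lies in an infinite cluster.

  Below \<open>p\<^sub>c\<close> this limit is \<open>0\<close> (\<open>theta_subcritical\<close>). A component with \<open>\<alpha>|G\<^sub>n|\<close> vertices would
  consist of \<open>\<alpha>|G\<^sub>n|\<close> vertices whose cluster has size at least \<open>k\<close>, while the expected number of these is
  at most \<open>(\<theta>\<^sub>k + o(1))|G\<^sub>n|\<close>; Markov's inequality concludes (\<open>giant_markov\<close>).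

  Above \<open>p\<^sub>c\<close>, fix \<open>p\<^sub>1\<close> with \<open>p\<^sub>c \<le> p\<^sub>1 < p\<close> at which \<open>\<rho>\<close> has probability at least \<open>\<delta> > 0\<close> of lying in an
  infinite cluster (\<open>theta_supercritical\<close>), and realise \<open>p\<close>-percolation as the union of independent
  percolations with parameters \<open>p\<^sub>1\<close> and \<open>q\<close>, where \<open>1 - p = (1 - p\<^sub>1)(1 - q)\<close>. For every fixed \<open>k\<close>, a
  second moment bound shows that with high probability at least \<open>\<delta>|G\<^sub>n|/2\<close> vertices lie in \<open>p\<^sub>1\<close>-clusters of
  size at least \<open>k\<close> (\<open>big_vertices_lower_tail\<close>). If after adding the \<open>q\<close>-edges (the sprinkling) no
  component is of linear size, these vertices can be divided into two sets of linear size, both unions of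
  \<open>p\<^sub>1\<close>-clusters, with no connection between them (\<open>saturated_halving\<close>). There are at most
  \<open>|G\<^sub>n|/k\<close> such clusters, hence at most \<open>2 ^ (|G\<^sub>n|/k)\<close> divisions (\<open>card_saturated_subsets\<close>).
  The Cheeger bound forces a number \<open>c|G\<^sub>n|\<close> of edge-disjoint connections of length at most \<open>L\<close> between the
  two sets, with \<open>c\<close> and \<open>L\<close> independent of \<open>k\<close> (\<open>many_disjoint_connections\<close>); a given division thus survives
  with probability at most \<open>(1 - q ^ L) ^ (c|G\<^sub>n|)\<close>. For \<open>k\<close> large the union bound over
  divisions is exponentially small (\<open>sprinkling_fails\<close>).
\<close>

section \<open>Bond percolation on finite edge sets\<close>

text \<open>Percolation on a finite edge set as a discrete distribution, so that conditioning and coupling become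
  manipulations of the probability monad. Edges outside \<open>E\<close> are closed.\<close>

definition bond_perc :: "'e set \<Rightarrow> real \<Rightarrow> ('e \<Rightarrow> bool) pmf" where
  "bond_perc E p = Pi_pmf E False (\<lambda>_. bernoulli_pmf p)"

definition supported_on :: "'e set \<Rightarrow> (('e \<Rightarrow> bool) \<Rightarrow> bool) \<Rightarrow> bool" where
  "supported_on F Q \<longleftrightarrow> (\<forall>\<omega> \<omega>'. (\<forall>e\<in>F. \<omega> e = \<omega>' e) \<longrightarrow> Q \<omega> = Q \<omega>')"

lemma supported_onD: "supported_on F Q \<Longrightarrow> (\<And>e. e \<in> F \<Longrightarrow> \<omega> e = \<omega>' e) \<Longrightarrow> Q \<omega> = Q \<omega>'"
  unfolding supported_on_def by blast

lemma finite_set_bond_perc: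
  assumes "finite E"
  shows "finite (set_pmf (bond_perc E p))"
proof -
  have "set_pmf (bond_perc E p) \<subseteq> PiE_dflt E False (\<lambda>_. UNIV)"
    using set_Pi_pmf_subset[OF assms, of False "\<lambda>_. bernoulli_pmf p"]
    by (auto simp: bond_perc_def PiE_dflt_def)
  thus ?thesis by (rule finite_subset) (use assms in auto)
qed

lemma prob_pair_pmf_Times:
  "measure_pmf.prob (pair_pmf M N) (A \<times> B) = measure_pmf.prob M A * measure_pmf.prob N B"
proof -
  have "measure_pmf.prob (pair_pmf M N) (A \<times> B)
      = measure_pmf.prob (pair_pmf M N) ((A \<inter> set_pmf M) \<times> (B \<inter> set_pmf N))"
    by (subst measure_Int_set_pmf[symmetric]) (auto intro!: arg_cong[where f = "measure _"])
  also have "\<dots> = measure_pmf.prob M (A \<inter> set_pmf M) * measure_pmf.prob N (B \<inter> set_pmf N)"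
    by (intro measure_pmf_prob_product) (auto intro: countable_subset)
  finally show ?thesis by (simp add: measure_Int_set_pmf)
qed

lemma bond_perc_subset:
  assumes "finite E" "F \<subseteq> E" "supported_on F Q"
  shows "measure_pmf.prob (bond_perc E p) {\<omega>. Q \<omega>} = measure_pmf.prob (bond_perc F p) {\<omega>. Q \<omega>}"
proof -
  have "Q (\<lambda>x. if x \<in> F then f x else False) = Q f" for f
    by (rule supported_onD[OF assms(3)]) auto
  thus ?thesis unfolding bond_perc_def
    by (simp only: Pi_pmf_subset[OF assms(1,2)] measure_map_pmf vimage_def mem_Collect_eq)
qed

lemma bond_perc_indep:
  assumes "finite E" "A \<inter> B = {}" "A \<subseteq> E" "B \<subseteq> E" "supported_on A P" "supported_on B Q"
  shows "measure_pmf.prob (bond_perc E p) {\<omega>. P \<omega> \<and> Q \<omega>}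
    = measure_pmf.prob (bond_perc E p) {\<omega>. P \<omega>} * measure_pmf.prob (bond_perc E p) {\<omega>. Q \<omega>}"
proof -
  have fin: "finite A" "finite B" using assms by (auto intro: finite_subset)
  have PQ: "supported_on (A \<union> B) (\<lambda>\<omega>. P \<omega> \<and> Q \<omega>)"
    using assms(5,6) unfolding supported_on_def by blast
  have "measure_pmf.prob (bond_perc E p) {\<omega>. P \<omega> \<and> Q \<omega>}
      = measure_pmf.prob (bond_perc (A \<union> B) p) {\<omega>. P \<omega> \<and> Q \<omega>}"
    using assms by (intro bond_perc_subset[OF _ _ PQ]) auto
  also have "\<dots> = measure_pmf.prob (pair_pmf (bond_perc A p) (bond_perc B p)) ({\<omega>. P \<omega>} \<times> {\<omega>. Q \<omega>})"
  proof -
    have 1: "P (\<lambda>x. if x \<in> A then f x else g x) = P f" for f g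
      by (rule supported_onD[OF assms(5)]) auto
    have 2: "Q (\<lambda>x. if x \<in> A then f x else g x) = Q g" for f g
      by (rule supported_onD[OF assms(6)]) (use assms(2) in auto)
    have "(\<lambda>(f, g) x. if x \<in> A then f x else g x) -` {\<omega>. P \<omega> \<and> Q \<omega>} = {\<omega>. P \<omega>} \<times> {\<omega>. Q \<omega>}"
      by (auto simp only: vimage_def mem_Collect_eq split_beta 1 2 mem_Times_iff fst_conv snd_conv)
    thus ?thesis unfolding bond_perc_def
      by (simp only: Pi_pmf_union[OF fin assms(2)] measure_map_pmf)
  qed
  also have "\<dots> = measure_pmf.prob (bond_perc A p) {\<omega>. P \<omega>} * measure_pmf.prob (bond_perc B p) {\<omega>. Q \<omega>}"
    by (rule prob_pair_pmf_Times)
  also have "\<dots> = measure_pmf.prob (bond_perc E p) {\<omega>. P \<omega>} * measure_pmf.prob (bond_perc E p) {\<omega>. Q \<omega>}"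
    using assms by (simp add: bond_perc_subset)
  finally show ?thesis .
qed

lemma bond_perc_all_open:
  assumes "finite E" "F \<subseteq> E" "0 \<le> p" "p \<le> 1"
  shows "measure_pmf.prob (bond_perc E p) {\<omega>. \<forall>e\<in>F. \<omega> e} = p ^ card F"
proof -
  have fin: "finite F" using assms finite_subset by auto
  have "measure_pmf.prob (bond_perc E p) {\<omega>. \<forall>e\<in>F. \<omega> e} = measure_pmf.prob (bond_perc F p) {\<omega>. \<forall>e\<in>F. \<omega> e}"
    using assms by (intro bond_perc_subset) (auto simp: supported_on_def)
  also have "{\<omega>. \<forall>e\<in>F. \<omega> e} = Pi F (\<lambda>_. {True})" by (auto simp: Pi_def)
  also have "measure_pmf.prob (bond_perc F p) \<dots> = (\<Prod>e\<in>F. measure_pmf.prob (bernoulli_pmf p) {True})"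
    unfolding bond_perc_def by (rule measure_Pi_pmf_Pi[OF fin])
  also have "\<dots> = p ^ card F" using assms by (simp add: measure_pmf_single)
  finally show ?thesis by (simp add: Pi_def Ball_def)
qed

text \<open>Disjoint sets of edges are independent, so that the failure probabilities multiply. This is the bound
  on the probability that none of a family of edge-disjoint paths is open.\<close>

lemma bond_perc_none_open_le:
  assumes "finite E" "finite \<F>" "disjoint \<F>" "\<And>F. F \<in> \<F> \<Longrightarrow> F \<subseteq> E \<and> card F \<le> L"
    and "0 \<le> q" "q \<le> 1"
  shows "measure_pmf.prob (bond_perc E q) {\<omega>. \<forall>F\<in>\<F>. \<not> (\<forall>e\<in>F. \<omega> e)} \<le> (1 - q ^ L) ^ card \<F>"
  using assms(2-4)
proof (induction \<F> rule: finite_induct)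
  case empty
  show ?case by simp
next
  case (insert F \<F>)
  have dj: "F \<inter> \<Union>\<F> = {}"
    using insert.prems(1) insert.hyps(2) by (auto simp: disjoint_def)
  have q: "q ^ L \<le> q ^ card F"
    using insert.prems(2)[of F] assms(5,6) by (intro power_decreasing) auto
  have qL: "q ^ L \<le> 1" using assms(5,6) by (rule power_le_one)
  have "measure_pmf.prob (bond_perc E q) {\<omega>. \<forall>F\<in>insert F \<F>. \<not> (\<forall>e\<in>F. \<omega> e)}
     = measure_pmf.prob (bond_perc E q) {\<omega>. \<not> (\<forall>e\<in>F. \<omega> e) \<and> (\<forall>F\<in>\<F>. \<not> (\<forall>e\<in>F. \<omega> e))}"
    by (intro arg_cong[where f = "measure _"]) auto
  also have "\<dots> = measure_pmf.prob (bond_perc E q) {\<omega>. \<not> (\<forall>e\<in>F. \<omega> e)} *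
      measure_pmf.prob (bond_perc E q) {\<omega>. \<forall>F\<in>\<F>. \<not> (\<forall>e\<in>F. \<omega> e)}"
    by (rule bond_perc_indep[OF assms(1) dj])
      (use insert.prems(2) in \<open>auto simp: supported_on_def\<close>)
  also have "\<dots> \<le> (1 - q ^ L) * (1 - q ^ L) ^ card \<F>"
  proof (rule mult_mono)
    have "measure_pmf.prob (bond_perc E q) {\<omega>. \<not> (\<forall>e\<in>F. \<omega> e)} = 1 - q ^ card F"
      using measure_pmf.prob_compl[of "{\<omega>. \<forall>e\<in>F. \<omega> e}" "bond_perc E q"]
        bond_perc_all_open[OF assms(1), of F q] insert.prems(2)[of F] assms(5,6)
      by (simp add: Compl_eq_Diff_UNIV[symmetric] Collect_neg_eq[symmetric])
    thus "measure_pmf.prob (bond_perc E q) {\<omega>. \<not> (\<forall>e\<in>F. \<omega> e)} \<le> 1 - q ^ L" using q by simp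
    show "measure_pmf.prob (bond_perc E q) {\<omega>. \<forall>F\<in>\<F>. \<not> (\<forall>e\<in>F. \<omega> e)} \<le> (1 - q ^ L) ^ card \<F>"
      using insert.prems by (intro insert.IH) (auto simp: disjoint_def pairwise_def)
  qed (use qL in auto)
  also have "\<dots> = (1 - q ^ L) ^ card (insert F \<F>)" using insert.hyps by simp
  finally show ?case .
qed

text \<open>An edge is closed in the union of two independent percolations when it is closed in both:
  the second parameter is the solution \<open>q\<close> of \<open>1 - p = (1 - p1) (1 - q)\<close>.\<close>

lemma bernoulli_or:
  assumes "0 \<le> p1" "p1 < 1" "p1 \<le> p" "p \<le> 1"
  shows "bind_pmf (bernoulli_pmf p1) (\<lambda>b. map_pmf (\<lambda>c. b \<or> c) (bernoulli_pmf ((p - p1) / (1 - p1))))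
     = bernoulli_pmf p"
proof (rule pmf_eqI)
  fix b
  have q: "0 \<le> (p - p1) / (1 - p1)" "(p - p1) / (1 - p1) \<le> 1" using assms by auto
  have T: "map_pmf (\<lambda>c. True \<or> c) (bernoulli_pmf r) = return_pmf True" for r
    by simp
  have "(\<or>) False = (\<lambda>c. c)" by auto
  hence F: "map_pmf ((\<or>) False) (bernoulli_pmf r) = bernoulli_pmf r" for r
    by (simp add: pmf.map_ident)
  show "pmf (bind_pmf (bernoulli_pmf p1) (\<lambda>b. map_pmf (\<lambda>c. b \<or> c) (bernoulli_pmf ((p - p1) / (1 - p1))))) b
     = pmf (bernoulli_pmf p) b"
    using assms q by (cases b) (auto simp: pmf_bind T F field_simps)
qed

text \<open>The sprinkling coupling: a \<open>p\<close>-configuration arises from a \<open>p1\<close>-configuration \<open>f\<close> by independently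
  opening further edges.\<close>

lemma bond_perc_sprinkle:
  assumes "finite E" "0 \<le> p1" "p1 < 1" "p1 \<le> p" "p \<le> 1"
  shows "bond_perc E p = bind_pmf (bond_perc E p1)
           (\<lambda>f. map_pmf (\<lambda>g e. f e \<or> g e) (bond_perc E ((p - p1) / (1 - p1))))"
proof -
  let ?q = "(p - p1) / (1 - p1)"
  have "bond_perc E p = Pi_pmf E False (\<lambda>_. bind_pmf (bernoulli_pmf p1)
      (\<lambda>b. map_pmf (\<lambda>c. b \<or> c) (bernoulli_pmf ?q)))"
    unfolding bond_perc_def using bernoulli_or[OF assms(2-5)] by simp
  also have "\<dots> = bind_pmf (bond_perc E p1)
      (\<lambda>f. Pi_pmf E False (\<lambda>e. map_pmf (\<lambda>c. f e \<or> c) (bernoulli_pmf ?q)))"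
    unfolding bond_perc_def by (rule Pi_pmf_bind[OF assms(1)])
  also have "\<dots> = bind_pmf (bond_perc E p1) (\<lambda>f. map_pmf (\<lambda>g e. f e \<or> g e) (bond_perc E ?q))"
  proof (rule bind_pmf_cong[OF refl])
    fix f assume f: "f \<in> set_pmf (bond_perc E p1)"
    have f0: "e \<notin> E \<Longrightarrow> f e = False" for e
      using f set_Pi_pmf_subset[OF assms(1), of False "\<lambda>_. bernoulli_pmf p1"]
      unfolding bond_perc_def by auto
    show "Pi_pmf E False (\<lambda>e. map_pmf (\<lambda>c. f e \<or> c) (bernoulli_pmf ?q))
      = map_pmf (\<lambda>g e. f e \<or> g e) (bond_perc E ?q)"
    proof -
      have "Pi_pmf E False (\<lambda>e. map_pmf (\<lambda>c. f e \<or> c) (bernoulli_pmf ?q))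
        = Pi_pmf E False (\<lambda>e. bind_pmf (bernoulli_pmf ?q) (\<lambda>c. return_pmf (f e \<or> c)))"
        by (simp add: map_pmf_def)
      also have "\<dots> = bind_pmf (bond_perc E ?q) (\<lambda>g. return_pmf (\<lambda>e. if e \<in> E then f e \<or> g e else False))"
        unfolding bond_perc_def using assms(1) by (subst Pi_pmf_bind[where d' = False]) auto
      also have "\<dots> = map_pmf (\<lambda>g e. f e \<or> g e) (bond_perc E ?q)"
        unfolding map_pmf_def
      proof (rule bind_pmf_cong[OF refl])
        fix g assume "g \<in> set_pmf (bond_perc E ?q)"
        hence "e \<notin> E \<Longrightarrow> g e = False" for e
          using set_Pi_pmf_subset[OF assms(1), of False "\<lambda>_. bernoulli_pmf ?q"]
          unfolding bond_perc_def by auto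
        thus "return_pmf (\<lambda>e. if e \<in> E then f e \<or> g e else False) = return_pmf (\<lambda>e. f e \<or> g e)"
          using f0 by (auto simp: fun_eq_iff)
      qed
      finally show ?thesis .
    qed
  qed
  finally show ?thesis .
qed

text \<open>The bridge from the product measure on a possibly infinite edge set to finite percolation: an event
  read off finitely many edges is a finite disjoint union of cylinders.\<close>

lemma percolation_finite_support:
  assumes F: "finite F" "F \<subseteq> edges G" and Q: "supported_on F Q"
  shows "{\<omega> \<in> space (percolation G p). Q \<omega>} \<in> sets (percolation G p)" (is ?A)
    and "\<P>(\<omega> in percolation G p. Q \<omega>) = measure_pmf.prob (bond_perc F p) {\<omega>. Q \<omega>}" (is ?B)
proof -
  let ?M = "percolation G p"
  interpret P: product_prob_space "\<lambda>_. measure_pmf (bernoulli_pmf p)" "edges G"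
    by unfold_locales
  define D where "D = PiE_dflt F False (\<lambda>_. UNIV :: bool set)"
  (* The cylinder of configurations that agree with f on F. *)
  define Z where "Z f = {\<omega> \<in> space ?M. \<forall>e\<in>F. \<omega> e \<in> {f e}}" for f
  have finD: "finite D" unfolding D_def using F(1) by auto
  have Zm: "Z f \<in> sets ?M" for f
  proof -
    have "Z f = prod_emb (edges G) (\<lambda>_. measure_pmf (bernoulli_pmf p)) F (PiE F (\<lambda>e. {f e}))"
      unfolding Z_def prod_emb_def percolation_def using F by (auto simp: space_PiM Pi_iff)
    thus ?thesis unfolding percolation_def using F by (auto intro!: sets_PiM_I)
  qed
  have Zp: "measure ?M (Z f) = pmf (bond_perc F p) f" if "f \<in> D" for f
  proof -
    have "emeasure ?M (Z f) = (\<Prod>e\<in>F. emeasure (measure_pmf (bernoulli_pmf p)) {f e})"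
      unfolding Z_def percolation_def by (rule P.emeasure_PiM_Collect) (use F in auto)
    also have "\<dots> = ennreal (\<Prod>e\<in>F. pmf (bernoulli_pmf p) (f e))"
      by (simp add: emeasure_pmf_single prod_ennreal)
    finally have "measure ?M (Z f) = (\<Prod>e\<in>F. pmf (bernoulli_pmf p) (f e))"
      by (simp add: measure_def prod_nonneg)
    thus ?thesis using that F(1) unfolding bond_perc_def D_def
      by (subst pmf_Pi') (auto simp: PiE_dflt_def)
  qed
  have eq: "{\<omega> \<in> space ?M. Q \<omega>} = (\<Union>f\<in>{f\<in>D. Q f}. Z f)"
  proof (intro equalityI subsetI)
    fix \<omega> assume w: "\<omega> \<in> {\<omega> \<in> space ?M. Q \<omega>}"
    let ?f = "\<lambda>e. e \<in> F \<and> \<omega> e"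
    have "Q ?f = Q \<omega>" by (rule supported_onD[OF Q]) auto
    thus "\<omega> \<in> (\<Union>f\<in>{f\<in>D. Q f}. Z f)" using w
      by (intro UN_I[of ?f]) (auto simp: D_def Z_def PiE_dflt_def)
  next
    fix \<omega> assume "\<omega> \<in> (\<Union>f\<in>{f\<in>D. Q f}. Z f)"
    then obtain f where f: "f \<in> D" "Q f" "\<omega> \<in> Z f" by auto
    have "Q f = Q \<omega>" by (rule supported_onD[OF Q]) (use f(3) in \<open>auto simp: Z_def\<close>)
    thus "\<omega> \<in> {\<omega> \<in> space ?M. Q \<omega>}" using f by (auto simp: Z_def)
  qed
  show ?A unfolding eq using finD Zm by auto
  have disj: "disjoint_family_on Z D"
    unfolding disjoint_family_on_def Z_def D_def PiE_dflt_def by (auto simp: fun_eq_iff)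
  have "\<P>(\<omega> in ?M. Q \<omega>) = (\<Sum>f\<in>{f\<in>D. Q f}. measure ?M (Z f))"
    unfolding eq
  proof (rule finite_measure.finite_measure_finite_Union)
    show "finite_measure ?M" unfolding percolation_def by (rule P.finite_measure_axioms)
  qed (use finD Zm disj in \<open>auto simp: disjoint_family_on_def\<close>)
  also have "\<dots> = measure_pmf.prob (bond_perc F p) {f\<in>D. Q f}"
    using finD by (subst measure_measure_pmf_finite) (auto simp: Zp)
  also have "\<dots> = measure_pmf.prob (bond_perc F p) ({\<omega>. Q \<omega>} \<inter> set_pmf (bond_perc F p))"
  proof (subst (1) measure_Int_set_pmf[symmetric], rule arg_cong[where f = "measure _"])
    have "set_pmf (bond_perc F p) \<subseteq> D"
      using set_Pi_pmf_subset[OF F(1), of False "\<lambda>_. bernoulli_pmf p"]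
      by (auto simp: bond_perc_def D_def PiE_dflt_def)
    thus "{f\<in>D. Q f} \<inter> set_pmf (bond_perc F p) = {\<omega>. Q \<omega>} \<inter> set_pmf (bond_perc F p)" by auto
  qed
  also have "\<dots> = measure_pmf.prob (bond_perc F p) {\<omega>. Q \<omega>}" by (rule measure_Int_set_pmf)
  finally show ?B .
qed

section \<open>Clusters, walk balls and locality\<close>

definition arcs :: "'a set set \<Rightarrow> 'a rel" where
  "arcs E = {(u, v). {u, v} \<in> E}"

definition cluster :: "'a set set \<Rightarrow> 'a \<Rightarrow> 'a set" where
  "cluster E v = {u. (v, u) \<in> (arcs E)\<^sup>*}"

definition walk_ball :: "'a set set \<Rightarrow> nat \<Rightarrow> 'a \<Rightarrow> 'a set" where
  "walk_ball E k v = {u. \<exists>j\<le>k. (v, u) \<in> arcs E ^^ j}"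

text \<open>A truncated form of ``the cluster of \<open>v\<close> has at least \<open>k\<close> vertices'' that only looks at walks of
  length at most \<open>k\<close>; the two agree by \<open>big_iff_cluster\<close> below.\<close>

definition big :: "'a set set \<Rightarrow> nat \<Rightarrow> 'a \<Rightarrow> bool" where
  "big E k v \<longleftrightarrow> k \<le> card (walk_ball E k v)"

text \<open>The vertex \<open>v\<close> ranges over the whole type, which makes the bound inherited by every smaller edge set
  without reference to a vertex set.\<close>

definition bounded_deg :: "'a set set \<Rightarrow> nat \<Rightarrow> bool" where
  "bounded_deg E d \<longleftrightarrow> (\<forall>v. finite {e\<in>E. v \<in> e} \<and> card {e\<in>E. v \<in> e} \<le> d)"

definition ball_edges :: "'a set set \<Rightarrow> nat \<Rightarrow> 'a \<Rightarrow> 'a set set" where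
  "ball_edges E k v = {e\<in>E. e \<subseteq> walk_ball E k v}"

text \<open>The probability that the open cluster of \<open>v\<close> has at least \<open>k\<close> vertices, written as a finite
  percolation probability on the edges of the ball of radius \<open>k\<close>.\<close>

definition theta :: "'a set set \<Rightarrow> real \<Rightarrow> nat \<Rightarrow> 'a \<Rightarrow> real" where
  "theta E p k v = measure_pmf.prob (bond_perc (ball_edges E k v) p) {\<omega>. big {e\<in>E. \<omega> e} k v}"

lemma adj_eq_arcs: "adj G = arcs (edges G)"
  by (simp add: adj_def arcs_def)

lemma sym_arcs: "sym (arcs E)"
  by (auto simp: sym_def arcs_def insert_commute)

lemma arcs_mono: "E \<subseteq> F \<Longrightarrow> arcs E \<subseteq> arcs F"
  by (auto simp: arcs_def)

lemma cluster_mono: "E \<subseteq> F \<Longrightarrow> cluster E v \<subseteq> cluster F v"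
  unfolding cluster_def using rtrancl_mono[OF arcs_mono, of E F] by auto

lemma cluster_self [simp]: "v \<in> cluster E v"
  by (simp add: cluster_def)

lemma cluster_eq:
  assumes "u \<in> cluster E v"
  shows "cluster E u = cluster E v"
proof -
  have s: "sym ((arcs E)\<^sup>*)" by (rule sym_rtrancl[OF sym_arcs])
  have "(v, u) \<in> (arcs E)\<^sup>*" using assms by (simp add: cluster_def)
  moreover have "(u, v) \<in> (arcs E)\<^sup>*" using calculation s by (meson symD)
  ultimately show ?thesis unfolding cluster_def by (auto intro: rtrancl_trans)
qed

lemma cluster_sym: "u \<in> cluster E v \<longleftrightarrow> v \<in> cluster E u"
  using cluster_eq cluster_self by metis

lemma walk_ball_0 [simp]: "walk_ball E 0 v = {v}"
  by (auto simp: walk_ball_def)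

lemma walk_ball_Suc:
  "walk_ball E (Suc k) v = walk_ball E k v \<union> {w. \<exists>u\<in>walk_ball E k v. {u, w} \<in> E}"
proof (intro equalityI subsetI)
  fix w assume "w \<in> walk_ball E (Suc k) v"
  then obtain j where j: "j \<le> Suc k" "(v, w) \<in> arcs E ^^ j" by (auto simp: walk_ball_def)
  show "w \<in> walk_ball E k v \<union> {w. \<exists>u\<in>walk_ball E k v. {u, w} \<in> E}"
  proof (cases j)
    case 0
    thus ?thesis using j(2) by (auto simp: walk_ball_def intro!: exI[of _ 0])
  next
    case (Suc i)
    then obtain u where "(v, u) \<in> arcs E ^^ i" "(u, w) \<in> arcs E" using j(2) by auto
    thus ?thesis using j(1) Suc by (auto simp: walk_ball_def arcs_def)
  qed
next
  fix w assume "w \<in> walk_ball E k v \<union> {w. \<exists>u\<in>walk_ball E k v. {u, w} \<in> E}"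
  thus "w \<in> walk_ball E (Suc k) v"
  proof
    assume "w \<in> walk_ball E k v"
    thus ?thesis by (auto simp: walk_ball_def intro: le_SucI)
  next
    assume "w \<in> {w. \<exists>u\<in>walk_ball E k v. {u, w} \<in> E}"
    then obtain u j where u: "{u, w} \<in> E" "j \<le> k" "(v, u) \<in> arcs E ^^ j"
      by (auto simp: walk_ball_def)
    have "(v, w) \<in> arcs E ^^ Suc j" using u by (auto simp: arcs_def)
    thus ?thesis using u(2) unfolding walk_ball_def by blast
  qed
qed

lemma walk_ball_mono_radius: "j \<le> k \<Longrightarrow> walk_ball E j v \<subseteq> walk_ball E k v"
  unfolding walk_ball_def using le_trans by blast

lemma walk_ball_self [simp]: "v \<in> walk_ball E k v"
  using walk_ball_mono_radius[of 0 k E v] by simp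

lemma walk_ball_mono: "E \<subseteq> F \<Longrightarrow> walk_ball E k v \<subseteq> walk_ball F k v"
  by (induction k) (auto simp: walk_ball_Suc)

lemma walk_ball_subset_cluster: "walk_ball E k v \<subseteq> cluster E v"
  unfolding walk_ball_def cluster_def by (auto dest: relpow_imp_rtrancl)

lemma walk_ball_sym: "w \<in> walk_ball E k v \<longleftrightarrow> v \<in> walk_ball E k w"
proof -
  have "(w, v) \<in> arcs E ^^ j" if "(v, w) \<in> arcs E ^^ j" for v w j
    using that
  proof (induction j arbitrary: w)
    case (Suc j)
    then obtain u where u: "(v, u) \<in> arcs E ^^ j" "(u, w) \<in> arcs E" by auto
    hence "(w, u) \<in> arcs E" using sym_arcs[of E] by (auto dest: symD)
    with Suc.IH[OF u(1)] show ?case by (rule relpow_Suc_I2[rotated])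
  qed auto
  thus ?thesis by (auto simp: walk_ball_def)
qed

lemma walk_ball_trans:
  assumes "u \<in> walk_ball E j v" "w \<in> walk_ball E k u"
  shows "w \<in> walk_ball E (j + k) v"
proof -
  obtain i l where "i \<le> j" "(v, u) \<in> arcs E ^^ i" "l \<le> k" "(u, w) \<in> arcs E ^^ l"
    using assms by (auto simp: walk_ball_def)
  hence "(v, w) \<in> arcs E ^^ (i + l)" "i + l \<le> j + k" by (auto simp: relpow_add)
  thus ?thesis unfolding walk_ball_def by blast
qed

lemma bounded_deg_mono: "bounded_deg F d \<Longrightarrow> E \<subseteq> F \<Longrightarrow> bounded_deg E d"
  unfolding bounded_deg_def
proof (intro allI)
  fix v assume a: "\<forall>v. finite {e\<in>F. v \<in> e} \<and> card {e\<in>F. v \<in> e} \<le> d" "E \<subseteq> F"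
  have "{e\<in>E. v \<in> e} \<subseteq> {e\<in>F. v \<in> e}" using a(2) by auto
  with a(1) show "finite {e\<in>E. v \<in> e} \<and> card {e\<in>E. v \<in> e} \<le> d"
    by (meson card_mono finite_subset le_trans)
qed

lemma card_neighbours_le:
  assumes "bounded_deg E d"
  shows "finite {w. {u, w} \<in> E}" "card {w. {u, w} \<in> E} \<le> d"
proof -
  have inj: "inj_on (\<lambda>w. {u, w}) {w. {u, w} \<in> E}"
    by (auto simp: inj_on_def doubleton_eq_iff)
  have sub: "(\<lambda>w. {u, w}) ` {w. {u, w} \<in> E} \<subseteq> {e\<in>E. u \<in> e}" by auto
  have fin: "finite {e\<in>E. u \<in> e}" "card {e\<in>E. u \<in> e} \<le> d"
    using assms by (auto simp: bounded_deg_def)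
  show "finite {w. {u, w} \<in> E}" by (rule inj_on_finite[OF inj sub fin(1)])
  show "card {w. {u, w} \<in> E} \<le> d" using card_inj_on_le[OF inj sub fin(1)] fin(2) by simp
qed

lemma walk_ball_finite_card:
  assumes "bounded_deg E d"
  shows "finite (walk_ball E k v) \<and> card (walk_ball E k v) \<le> (d + 1) ^ k"
proof (induction k)
  case (Suc k)
  have eq: "walk_ball E (Suc k) v = walk_ball E k v \<union> (\<Union>u\<in>walk_ball E k v. {w. {u, w} \<in> E})"
    by (auto simp: walk_ball_Suc)
  have "card (\<Union>u\<in>walk_ball E k v. {w. {u, w} \<in> E}) \<le> (\<Sum>u\<in>walk_ball E k v. card {w. {u, w} \<in> E})"
    using Suc by (intro card_UN_le) auto
  also have "\<dots> \<le> (\<Sum>u\<in>walk_ball E k v. d)"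
    by (intro sum_mono card_neighbours_le(2)[OF assms])
  finally have "card (walk_ball E (Suc k) v) \<le> card (walk_ball E k v) * (d + 1)"
    unfolding eq by (simp add: order_trans[OF card_Un_le])
  also have "\<dots> \<le> (d + 1) ^ k * (d + 1)" using Suc by (intro mult_right_mono) auto
  finally show ?case using Suc card_neighbours_le(1)[OF assms] unfolding eq by (auto simp: mult.commute)
qed auto

lemma finite_walk_ball: "bounded_deg E d \<Longrightarrow> finite (walk_ball E k v)"
  by (rule conjunct1[OF walk_ball_finite_card])

lemma card_walk_ball_le: "bounded_deg E d \<Longrightarrow> card (walk_ball E k v) \<le> (d + 1) ^ k"
  by (rule conjunct2[OF walk_ball_finite_card])

text \<open>Once a walk ball stops growing it is closed under adjacency.\<close>

lemma cluster_eq_walk_ball: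
  assumes "walk_ball E (Suc k) v = walk_ball E k v"
  shows "cluster E v = walk_ball E k v"
proof
  show "cluster E v \<subseteq> walk_ball E k v"
  proof
    fix w assume "w \<in> cluster E v"
    hence "(v, w) \<in> (arcs E)\<^sup>*" by (simp add: cluster_def)
    thus "w \<in> walk_ball E k v"
    proof induction
      case (step u w)
      hence "w \<in> walk_ball E (Suc k) v" by (auto simp: walk_ball_Suc arcs_def)
      thus ?case using assms by simp
    qed simp
  qed
qed (rule walk_ball_subset_cluster)

text \<open>Either some walk ball of radius below \<open>k\<close> is already the whole cluster, or each of the first \<open>k\<close> steps
  gains at least one vertex.\<close>

lemma big_iff_cluster:
  assumes "bounded_deg E d"
  shows "big E k v \<longleftrightarrow> infinite (cluster E v) \<or> k \<le> card (cluster E v)"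
proof
  assume b: "big E k v"
  show "infinite (cluster E v) \<or> k \<le> card (cluster E v)"
  proof (cases "finite (cluster E v)")
    case True
    hence "card (walk_ball E k v) \<le> card (cluster E v)"
      by (rule card_mono) (rule walk_ball_subset_cluster)
    thus ?thesis using b by (simp add: big_def)
  qed simp
next
  assume a: "infinite (cluster E v) \<or> k \<le> card (cluster E v)"
  have fin: "finite (walk_ball E j v)" for j by (rule finite_walk_ball[OF assms])
  show "big E k v"
  proof (cases "\<exists>j<k. walk_ball E (Suc j) v = walk_ball E j v")
    case True
    then obtain j where j: "j < k" "walk_ball E (Suc j) v = walk_ball E j v" by auto
    have cl: "cluster E v = walk_ball E j v" by (rule cluster_eq_walk_ball[OF j(2)])
    have "walk_ball E j v \<subseteq> walk_ball E k v" using j(1) by (intro walk_ball_mono_radius) simp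
    hence "card (cluster E v) \<le> card (walk_ball E k v)" using cl fin by (simp add: card_mono)
    moreover have "finite (cluster E v)" using cl fin by simp
    ultimately show ?thesis using a unfolding big_def by simp
  next
    case False
    have "j < card (walk_ball E j v)" if "j \<le> k" for j
      using that
    proof (induction j)
      case (Suc j)
      have "walk_ball E j v \<subset> walk_ball E (Suc j) v"
      proof
        show "walk_ball E j v \<noteq> walk_ball E (Suc j) v" using False Suc.prems by (metis Suc_le_lessD)
      qed (simp add: walk_ball_mono_radius)
      hence "card (walk_ball E j v) < card (walk_ball E (Suc j) v)" by (intro psubset_card_mono fin)
      thus ?case using Suc by simp
    qed simp
    from this[OF order_refl] show ?thesis by (simp add: big_def)
  qed
qed

lemma big_mono:
  assumes "bounded_deg F d" "E \<subseteq> F" "big E k v"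
  shows "big F k v"
proof -
  have "card (walk_ball E k v) \<le> card (walk_ball F k v)"
    by (intro card_mono walk_ball_mono[OF assms(2)] finite_walk_ball[OF assms(1)])
  thus ?thesis using assms(3) by (simp add: big_def)
qed

text \<open>A walk of length at most \<open>k\<close> in a subgraph never leaves the ball of radius \<open>k\<close> of the full graph.\<close>

lemma walk_ball_local:
  assumes "F \<subseteq> E"
  shows "walk_ball F k v = walk_ball (F \<inter> ball_edges E k v) k v"
proof -
  have "walk_ball F j v = walk_ball (F \<inter> ball_edges E k v) j v" if "j \<le> k" for j
    using that
  proof (induction j)
    case (Suc j)
    have "{u, w} \<in> ball_edges E k v" if "u \<in> walk_ball F j v" "{u, w} \<in> F" for u w
    proof -
      have "u \<in> walk_ball E j v" using that walk_ball_mono[OF assms] by auto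
      moreover from this have "w \<in> walk_ball E (Suc j) v" using that assms by (auto simp: walk_ball_Suc)
      ultimately show ?thesis
        using that Suc.prems assms walk_ball_mono_radius[of j k E v] walk_ball_mono_radius[of "Suc j" k E v]
        by (auto simp: ball_edges_def)
    qed
    thus ?case using Suc by (auto simp: walk_ball_Suc)
  qed simp
  thus ?thesis by simp
qed

lemma big_local: "big {e\<in>E. \<omega> e} k v \<longleftrightarrow> big {e\<in>ball_edges E k v. \<omega> e} k v"
proof -
  have "{e\<in>E. \<omega> e} \<inter> ball_edges E k v = {e\<in>ball_edges E k v. \<omega> e}" by (auto simp: ball_edges_def)
  moreover have "walk_ball {e\<in>E. \<omega> e} k v = walk_ball ({e\<in>E. \<omega> e} \<inter> ball_edges E k v) k v"
    by (rule walk_ball_local) auto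
  ultimately show ?thesis unfolding big_def by simp
qed

lemma supported_on_big: "supported_on (ball_edges E k v) (\<lambda>\<omega>. big {e\<in>E. \<omega> e} k v)"
proof -
  have "big {e\<in>E. \<omega> e} k v = big {e\<in>E. \<omega>' e} k v"
    if "\<forall>e\<in>ball_edges E k v. \<omega> e = \<omega>' e" for \<omega> \<omega>'
  proof -
    have "{e\<in>ball_edges E k v. \<omega> e} = {e\<in>ball_edges E k v. \<omega>' e}" using that by auto
    thus ?thesis using big_local[of E \<omega> k v] big_local[of E \<omega>' k v] by simp
  qed
  thus ?thesis unfolding supported_on_def by blast
qed

lemma finite_ball_edges:
  assumes "bounded_deg E d"
  shows "finite (ball_edges E k v)"
proof (rule finite_subset)
  show "ball_edges E k v \<subseteq> Pow (walk_ball E k v)" by (auto simp: ball_edges_def)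
qed (simp add: finite_walk_ball[OF assms])

lemma ball_edges_subset: "ball_edges E k v \<subseteq> E"
  by (auto simp: ball_edges_def)

lemma prob_big_eq_theta:
  assumes "finite E"
  shows "measure_pmf.prob (bond_perc E p) {\<omega>. big {e\<in>E. \<omega> e} k v} = theta E p k v"
  unfolding theta_def using bond_perc_subset[OF assms ball_edges_subset supported_on_big] .

lemma graph_dist_le_iff: "graph_dist G v u \<le> enat k \<longleftrightarrow> u \<in> walk_ball (edges G) k v"
proof
  assume a: "graph_dist G v u \<le> enat k"
  let ?S = "{k. (v, u) \<in> adj G ^^ k}"
  have "?S \<noteq> {}"
  proof
    assume "?S = {}"
    hence "graph_dist G v u = \<infinity>" unfolding graph_dist_def by (simp only: image_empty Inf_enat_def) simp
    thus False using a by simp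
  qed
  then obtain j where "j \<in> ?S" by blast
  hence "graph_dist G v u \<in> enat ` ?S" unfolding graph_dist_def by (intro wellorder_InfI[of "enat j"]) auto
  thus "u \<in> walk_ball (edges G) k v" using a by (auto simp: walk_ball_def adj_eq_arcs)
next
  assume "u \<in> walk_ball (edges G) k v"
  then obtain j where j: "j \<le> k" "(v, u) \<in> adj G ^^ j" by (auto simp: walk_ball_def adj_eq_arcs)
  hence "graph_dist G v u \<le> enat j" unfolding graph_dist_def by (intro INF_lower) auto
  also have "\<dots> \<le> enat k" using j by simp
  finally show "graph_dist G v u \<le> enat k" .
qed

lemma simple_cluster_subset:
  assumes "simple_graph G" "v \<in> verts G" "F \<subseteq> edges G"
  shows "cluster F v \<subseteq> verts G"
proof
  fix w assume "w \<in> cluster F v"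
  hence "(v, w) \<in> (arcs F)\<^sup>*" by (simp add: cluster_def)
  thus "w \<in> verts G"
  proof induction
    case (step u w)
    hence "{u, w} \<in> edges G" using assms(3) by (auto simp: arcs_def)
    thus ?case using assms(1) unfolding simple_graph_def by (fastforce simp: doubleton_eq_iff)
  qed (rule assms(2))
qed

lemma graph_ball_simps:
  assumes "simple_graph G" "v \<in> verts G"
  shows "verts (graph_ball G v k) = walk_ball (edges G) k v"
    and "edges (graph_ball G v k) = ball_edges (edges G) k v"
proof -
  have "walk_ball (edges G) k v \<subseteq> verts G"
    using walk_ball_subset_cluster simple_cluster_subset[OF assms order_refl] by (rule order_trans)
  thus "verts (graph_ball G v k) = walk_ball (edges G) k v"
    "edges (graph_ball G v k) = ball_edges (edges G) k v"
    by (auto simp: graph_ball_def induced_def graph_dist_le_iff ball_edges_def)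
qed

lemma bounded_deg_edges:
  assumes "simple_graph G" "degree_bound G d"
  shows "bounded_deg (edges G) d"
  unfolding bounded_deg_def
proof
  fix v
  show "finite {e\<in>edges G. v \<in> e} \<and> card {e\<in>edges G. v \<in> e} \<le> d"
  proof (cases "v \<in> verts G")
    case True
    thus ?thesis using assms(2) by (auto simp: degree_bound_def)
  next
    case False
    hence "{e\<in>edges G. v \<in> e} = {}" using assms(1) unfolding simple_graph_def by fastforce
    thus ?thesis by (simp only: finite.emptyI card.empty) simp
  qed
qed

lemma walk_ball_image:
  assumes f: "bij_betw f W W'" and F: "F \<subseteq> Pow W" "F' \<subseteq> Pow W'"
    and iso: "\<And>x y. x \<in> W \<Longrightarrow> y \<in> W \<Longrightarrow> {x, y} \<in> F \<longleftrightarrow> {f x, f y} \<in> F'"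
    and v: "v \<in> W"
  shows "walk_ball F' k (f v) = f ` walk_ball F k v \<and> walk_ball F k v \<subseteq> W"
proof (induction k)
  case (Suc k)
  have IH: "walk_ball F' k (f v) = f ` walk_ball F k v" "walk_ball F k v \<subseteq> W" using Suc by auto
  have sub: "walk_ball F (Suc k) v \<subseteq> W"
    using IH(2) F(1) unfolding walk_ball_Suc by blast
  have "walk_ball F' (Suc k) (f v) = f ` walk_ball F (Suc k) v"
  proof (intro equalityI subsetI)
    fix w' assume w': "w' \<in> walk_ball F' (Suc k) (f v)"
    show "w' \<in> f ` walk_ball F (Suc k) v"
    proof (cases "w' \<in> walk_ball F' k (f v)")
      case True
      thus ?thesis using IH(1) by (auto simp: walk_ball_Suc)
    next
      case False
      then obtain u where u: "u \<in> walk_ball F k v" "{f u, w'} \<in> F'"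
        using w' IH(1) by (auto simp: walk_ball_Suc)
      have "w' \<in> W'" using u(2) F(2) by auto
      then obtain w where w: "w \<in> W" "w' = f w" using f by (auto simp: bij_betw_def)
      hence "{u, w} \<in> F" using iso[of u w] u IH(2) by auto
      thus ?thesis using u(1) w by (auto simp: walk_ball_Suc)
    qed
  next
    fix w' assume "w' \<in> f ` walk_ball F (Suc k) v"
    then obtain w where w: "w \<in> walk_ball F (Suc k) v" "w' = f w" by auto
    show "w' \<in> walk_ball F' (Suc k) (f v)"
    proof (cases "w \<in> walk_ball F k v")
      case True
      thus ?thesis using IH(1) w(2) by (auto simp: walk_ball_Suc)
    next
      case False
      then obtain u where u: "u \<in> walk_ball F k v" "{u, w} \<in> F"
        using w(1) by (auto simp: walk_ball_Suc)
      hence "{f u, f w} \<in> F'" using iso[of u w] IH(2) sub w(1) by auto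
      moreover have "f u \<in> walk_ball F' k (f v)" using u(1) IH(1) by auto
      ultimately show ?thesis using w(2) by (auto simp: walk_ball_Suc)
    qed
  qed
  with sub show ?case by blast
qed (use v in auto)

text \<open>An isomorphism of balls maps edges to edges bijectively and hence transports percolation on one ball to
  percolation on the other, carrying open walk balls along. This is how weak convergence enters.\<close>

lemma theta_rooted_iso:
  assumes G: "simple_graph G" "u \<in> verts G" "bounded_deg (edges G) d"
    and H: "simple_graph H" "r \<in> verts H"
    and iso: "rooted_iso (graph_ball G u k) u (graph_ball H r k) r"
  shows "theta (edges G) p k u = theta (edges H) p k r"
proof -
  define B where "B = ball_edges (edges G) k u"
  define B' where "B' = ball_edges (edges H) k r"
  define W where "W = walk_ball (edges G) k u"
  define W' where "W' = walk_ball (edges H) k r"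
  obtain f where f: "bij_betw f W W'" "f u = r"
    and fe: "\<And>x y. x \<in> W \<Longrightarrow> y \<in> W \<Longrightarrow> {x, y} \<in> B \<longleftrightarrow> {f x, f y} \<in> B'"
    using iso unfolding rooted_iso_def graph_ball_simps[OF G(1,2)] graph_ball_simps[OF H]
    by (auto simp: B_def B'_def W_def W'_def)
  have BW: "B \<subseteq> Pow W" "B' \<subseteq> Pow W'" by (auto simp: B_def B'_def W_def W'_def ball_edges_def)
  have two: "\<exists>x y. e = {x, y} \<and> x \<in> W \<and> y \<in> W" if "e \<in> B" for e
    using that G(1) BW(1) unfolding simple_graph_def B_def ball_edges_def W_def by fastforce
  have two': "\<exists>x y. e = {x, y} \<and> x \<in> W' \<and> y \<in> W'" if "e \<in> B'" for e
    using that H(1) BW(2) unfolding simple_graph_def B'_def ball_edges_def W'_def by fastforce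
  have inj: "inj_on f W" and surj: "f ` W = W'" using f(1) by (auto simp: bij_betw_def)
  have bij: "bij_betw ((`) f) B B'"
    unfolding bij_betw_def
  proof
    show "inj_on ((`) f) B" using inj_on_image_Pow[OF inj] BW(1) inj_on_subset by blast
    show "(`) f ` B = B'"
    proof (intro equalityI subsetI)
      fix e' assume "e' \<in> (`) f ` B"
      then obtain e where "e \<in> B" "e' = f ` e" by auto
      thus "e' \<in> B'" using two[of e] fe by auto
    next
      fix e' assume e': "e' \<in> B'"
      then obtain x' y' where xy': "e' = {x', y'}" "x' \<in> W'" "y' \<in> W'" using two' by blast
      then obtain x y where xy: "x \<in> W" "y \<in> W" "x' = f x" "y' = f y" using surj by blast
      hence "{x, y} \<in> B" using fe e' xy' by auto
      thus "e' \<in> (`) f ` B" using xy xy' by (intro image_eqI[of _ _ "{x, y}"]) auto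
    qed
  qed
  (* Reindexing a product needs edges outside B to leave B'; the empty set is never an edge. *)
  define h where "h e = (if e \<in> B then f ` e else {})" for e
  have finB: "finite B" unfolding B_def by (rule finite_ball_edges[OF G(3)])
  have "bij_betw h B B' \<longleftrightarrow> bij_betw ((`) f) B B'" by (rule bij_betw_cong) (simp add: h_def)
  hence bijh: "bij_betw h B B'" using bij by simp
  have "{} \<notin> B'" using two' by force
  hence perc: "bond_perc B p = map_pmf (\<lambda>g. g \<circ> h) (bond_perc B' p)"
    unfolding bond_perc_def by (intro Pi_pmf_bij_betw[OF finB bijh]) (simp add: h_def)
  have "big {e\<in>edges G. (g \<circ> h) e} k u \<longleftrightarrow> big {e\<in>edges H. g e} k r" for g
  proof -
    have eq: "{e\<in>B. (g \<circ> h) e} = {e\<in>B. g (f ` e)}" by (auto simp: h_def)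
    have *: "walk_ball {e\<in>B'. g e} k (f u) = f ` walk_ball {e\<in>B. g (f ` e)} k u \<and>
        walk_ball {e\<in>B. g (f ` e)} k u \<subseteq> W"
      by (rule walk_ball_image[OF f(1)]) (use BW fe in \<open>auto simp: W_def\<close>)
    hence "card (walk_ball {e\<in>B'. g e} k r) = card (walk_ball {e\<in>B. g (f ` e)} k u)"
      using inj f(2) by (auto intro: card_image inj_on_subset)
    thus ?thesis
      by (subst (1 2) big_local) (simp add: big_def B_def[symmetric] B'_def[symmetric] eq[unfolded comp_def])
  qed
  thus ?thesis unfolding theta_def B_def[symmetric] B'_def[symmetric] perc by (simp add: vimage_def)
qed

section \<open>The infinite graph\<close>

lemma components_open_graph:
  assumes "simple_graph G"
  shows "components_of (open_graph G \<omega>) = cluster {e\<in>edges G. \<omega> e} ` verts G"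
proof -
  have "{u \<in> verts G. (v, u) \<in> (arcs {e\<in>edges G. \<omega> e})\<^sup>*} = cluster {e\<in>edges G. \<omega> e} v"
    if "v \<in> verts G" for v
    using simple_cluster_subset[OF assms that, of "{e\<in>edges G. \<omega> e}"] by (auto simp: cluster_def)
  thus ?thesis by (auto simp: components_of_def open_graph_def adj_eq_arcs)
qed

lemma infinite_cluster_iff:
  assumes "bounded_deg E d"
  shows "infinite (cluster E v) \<longleftrightarrow> (\<forall>k. big E k v)"
  using big_iff_cluster[OF assms, of _ v] by (metis Suc_n_not_le_n)

lemma bounded_deg_open: "bounded_deg E d \<Longrightarrow> bounded_deg {e\<in>E. \<omega> e} d"
  by (erule bounded_deg_mono) auto

lemma prob_space_percolation: "prob_space (percolation G p)"
  unfolding percolation_def by (intro prob_space_PiM prob_space_measure_pmf)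

context
  fixes G :: "'a ugraph" and d :: nat
  assumes G: "simple_graph G" "bounded_deg (edges G) d"
begin

lemma big_event:
  shows "{\<omega> \<in> space (percolation G p). big {e\<in>edges G. \<omega> e} k v} \<in> sets (percolation G p)"
    and "\<P>(\<omega> in percolation G p. big {e\<in>edges G. \<omega> e} k v) = theta (edges G) p k v"
  using percolation_finite_support[OF finite_ball_edges[OF G(2)] ball_edges_subset supported_on_big]
  unfolding theta_def by auto

lemma infinite_cluster_event:
  "{\<omega> \<in> space (percolation G p). infinite (cluster {e\<in>edges G. \<omega> e} v)} =
   (\<Inter>k. {\<omega> \<in> space (percolation G p). big {e\<in>edges G. \<omega> e} k v})"
  using infinite_cluster_iff[OF bounded_deg_open[OF G(2)]] by auto

lemma infinite_cluster_sets:
  "{\<omega> \<in> space (percolation G p). infinite (cluster {e\<in>edges G. \<omega> e} v)} \<in> sets (percolation G p)"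
  unfolding infinite_cluster_event by (rule sets.countable_INT) (auto intro: big_event(1))

text \<open>The events that the cluster of \<open>v\<close> has at least \<open>k\<close> vertices decrease in \<open>k\<close> to the event that it is
  infinite.\<close>

lemma theta_tendsto:
  "(\<lambda>k. theta (edges G) p k v) \<longlonglongrightarrow> \<P>(\<omega> in percolation G p. infinite (cluster {e\<in>edges G. \<omega> e} v))"
proof -
  interpret prob_space "percolation G p" by (rule prob_space_percolation)
  let ?A = "\<lambda>k. {\<omega> \<in> space (percolation G p). big {e\<in>edges G. \<omega> e} k v}"
  have "big {e\<in>edges G. \<omega> e} j v" if "j \<le> k" "big {e\<in>edges G. \<omega> e} k v" for j k \<omega>
    using that big_iff_cluster[OF bounded_deg_open[OF G(2)], of \<omega> _ v] by (meson le_trans)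
  hence "decseq ?A" by (auto simp: decseq_def)
  hence "(\<lambda>k. prob (?A k)) \<longlonglongrightarrow> prob (\<Inter>k. ?A k)"
    by (intro finite_Lim_measure_decseq) (auto intro: big_event(1))
  thus ?thesis by (simp only: big_event(2) infinite_cluster_event)
qed

lemma infinite_cluster_le_theta:
  "\<P>(\<omega> in percolation G p. infinite (cluster {e\<in>edges G. \<omega> e} v)) \<le> theta (edges G) p k v"
proof -
  interpret prob_space "percolation G p" by (rule prob_space_percolation)
  show ?thesis unfolding big_event(2)[symmetric]
    by (rule finite_measure_mono) (auto intro: big_event(1) simp: infinite_cluster_iff[OF bounded_deg_open[OF G(2)]])
qed

lemma infinite_component_event:
  "{\<omega> \<in> space (percolation G p). \<exists>C\<in>components_of (open_graph G \<omega>). infinite C} =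
   (\<Union>v\<in>verts G. {\<omega> \<in> space (percolation G p). infinite (cluster {e\<in>edges G. \<omega> e} v)})"
  by (auto simp: components_open_graph[OF G(1)])

text \<open>If the edge \<open>{u, w}\<close> is open then \<open>u\<close> and \<open>w\<close> share their cluster. Requiring that edge to be open is
  independent of the event that the cluster of \<open>w\<close> becomes big once that edge is added, and the latter is
  at least as likely as the cluster of \<open>w\<close> being big.\<close>

lemma edge_insertion:
  assumes e: "{u, w} \<in> edges G" and p: "0 \<le> p" "p \<le> 1"
  shows "p * theta (edges G) p k w \<le> theta (edges G) p k u"
proof -
  let ?E = "edges G" and ?e = "{u, w}"
  define F where "F = insert ?e (ball_edges ?E k u \<union> ball_edges ?E k w)"
  have F: "finite F" "ball_edges ?E k u \<subseteq> F" "ball_edges ?E k w \<subseteq> F" "F \<subseteq> ?E" "?e \<in> F"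
    using finite_ball_edges[OF G(2)] e ball_edges_subset[of ?E k] unfolding F_def by auto
  define opn where "opn \<omega> = {e\<in>?E. \<omega> e}" for \<omega>
  (* The open edges once e has been opened. *)
  define opn_e where "opn_e \<omega> = {e\<in>?E. \<omega> e \<or> e = ?e}" for \<omega>
  have supp2: "supported_on (F - {?e}) (\<lambda>\<omega>. big (opn_e \<omega>) k w)"
    unfolding supported_on_def
  proof (intro allI impI)
    fix \<omega> \<omega>' :: "'a set \<Rightarrow> bool" assume a: "\<forall>e\<in>F - {?e}. \<omega> e = \<omega>' e"
    show "big (opn_e \<omega>) k w = big (opn_e \<omega>') k w" unfolding opn_e_def
      by (rule supported_onD[OF supported_on_big]) (use a F(3) in auto)
  qed
  have "measure_pmf.prob (bond_perc F p) {\<omega>. \<omega> ?e \<and> big (opn_e \<omega>) k w}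
      = measure_pmf.prob (bond_perc F p) {\<omega>. \<omega> ?e} * measure_pmf.prob (bond_perc F p) {\<omega>. big (opn_e \<omega>) k w}"
    by (rule bond_perc_indep[OF F(1), of "{?e}" "F - {?e}"])
      (use F(5) supp2 in \<open>auto simp: supported_on_def\<close>)
  also have "measure_pmf.prob (bond_perc F p) {\<omega>. \<omega> ?e} = p"
    using bond_perc_all_open[OF F(1), of "{?e}" p] F(5) p by simp
  finally have 1: "measure_pmf.prob (bond_perc F p) {\<omega>. \<omega> ?e \<and> big (opn_e \<omega>) k w}
      = p * measure_pmf.prob (bond_perc F p) {\<omega>. big (opn_e \<omega>) k w}" .
  have deg: "bounded_deg (opn \<omega>) d" "bounded_deg (opn_e \<omega>) d" for \<omega>
    unfolding opn_def opn_e_def by (rule bounded_deg_open[OF G(2)])+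
  have "theta ?E p k w = measure_pmf.prob (bond_perc F p) {\<omega>. big (opn \<omega>) k w}"
    unfolding theta_def opn_def by (rule bond_perc_subset[OF F(1,3) supported_on_big, symmetric])
  also have "\<dots> \<le> measure_pmf.prob (bond_perc F p) {\<omega>. big (opn_e \<omega>) k w}"
  proof (rule measure_pmf.finite_measure_mono)
    have "big (opn_e \<omega>) k w" if "big (opn \<omega>) k w" for \<omega>
      using big_mono[OF deg(2) _ that] by (auto simp: opn_def opn_e_def)
    thus "{\<omega>. big (opn \<omega>) k w} \<subseteq> {\<omega>. big (opn_e \<omega>) k w}" by auto
  qed simp
  finally have "p * theta ?E p k w \<le> measure_pmf.prob (bond_perc F p) {\<omega>. \<omega> ?e \<and> big (opn_e \<omega>) k w}"
    unfolding 1 using p(1) by (rule mult_left_mono)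
  also have "\<dots> \<le> measure_pmf.prob (bond_perc F p) {\<omega>. big (opn \<omega>) k u}"
  proof (rule measure_pmf.finite_measure_mono)
    have "big (opn \<omega>) k u" if o: "\<omega> ?e" and b: "big (opn_e \<omega>) k w" for \<omega>
    proof -
      have "opn_e \<omega> = opn \<omega>" using o by (auto simp: opn_def opn_e_def)
      moreover have "w \<in> cluster (opn \<omega>) u"
        using o e by (auto simp: cluster_def arcs_def opn_def)
      hence "cluster (opn \<omega>) w = cluster (opn \<omega>) u" by (rule cluster_eq)
      ultimately show ?thesis using b deg(1)[of \<omega>] by (simp add: big_iff_cluster)
    qed
    thus "{\<omega>. \<omega> ?e \<and> big (opn_e \<omega>) k w} \<subseteq> {\<omega>. big (opn \<omega>) k u}" by auto
  qed simp
  also have "\<dots> = theta ?E p k u"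
    unfolding theta_def opn_def by (rule bond_perc_subset[OF F(1,2) supported_on_big])
  finally show ?thesis .
qed

text \<open>Inserting the edges of a path one after the other compares any two vertices of a connected graph, with
  a constant that is uniform in \<open>k\<close>.\<close>

lemma theta_cluster_le:
  assumes "w \<in> cluster (edges G) v" "0 < p" "p \<le> 1"
  shows "\<exists>c>0. \<forall>k. c * theta (edges G) p k v \<le> theta (edges G) p k w"
proof -
  have "(v, w) \<in> (arcs (edges G))\<^sup>*" using assms(1) by (simp add: cluster_def)
  thus ?thesis
  proof induction
    case base
    show ?case by (intro exI[of _ 1]) auto
  next
    case (step u w)
    then obtain c where c: "c > 0" "\<And>k. c * theta (edges G) p k v \<le> theta (edges G) p k u" by blast
    have "{w, u} \<in> edges G" using step(2) by (simp add: arcs_def insert_commute)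
    hence "p * theta (edges G) p k u \<le> theta (edges G) p k w" for k
      using assms by (intro edge_insertion) auto
    hence "(p * c) * theta (edges G) p k v \<le> theta (edges G) p k w" for k
      using mult_left_mono[OF c(2)[of k], of p] assms(2) by (smt (verit) mult.assoc)
    thus ?case using c(1) assms(2) by (intro exI[of _ "p * c"]) auto
  qed
qed

text \<open>With all edges closed every cluster is a singleton; this excludes \<open>0\<close> as a percolating parameter.\<close>

lemma theta_0: "theta (edges G) 0 2 v = 0"
proof -
  have "bernoulli_pmf 0 = return_pmf False"
    by (intro pmf_eqI) (auto simp: indicator_def)
  moreover have "\<not> big {} 2 v"
  proof -
    have "walk_ball {} 2 v = {v}" by (simp add: numeral_2_eq_2 walk_ball_Suc)
    thus ?thesis by (simp add: big_def)
  qed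
  ultimately show ?thesis
    unfolding theta_def bond_perc_def by (simp add: finite_ball_edges[OF G(2)] indicator_def)
qed

text \<open>At parameter \<open>1\<close> every edge is open. Together with \<open>theta_tendsto\<close> this shows that \<open>1\<close> belongs to the
  set whose infimum is the critical probability.\<close>

lemma theta_1:
  assumes "infinite (cluster (edges G) v)"
  shows "theta (edges G) 1 k v = 1"
proof -
  define \<omega>1 where "\<omega>1 = (\<lambda>e. if e \<in> ball_edges (edges G) k v then True else False)"
  have "bernoulli_pmf 1 = return_pmf True"
    by (intro pmf_eqI) (auto simp: indicator_def)
  moreover have "big {e\<in>edges G. \<omega>1 e} k v"
  proof -
    have "big {e\<in>edges G. \<omega>1 e} k v = big {e\<in>edges G. True} k v"
      by (rule supported_onD[OF supported_on_big]) (simp add: \<omega>1_def)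
    thus ?thesis using assms big_iff_cluster[OF G(2)] by simp
  qed
  ultimately show ?thesis
    unfolding theta_def bond_perc_def
    by (simp only: Pi_pmf_return_pmf[OF finite_ball_edges[OF G(2)]] measure_return_pmf \<omega>1_def[symmetric])
      (simp add: indicator_def)
qed

lemma countable_cluster: "countable (cluster (edges G) v)"
proof (rule countable_subset)
  show "cluster (edges G) v \<subseteq> (\<Union>k. walk_ball (edges G) k v)"
    
  proof
    fix u assume "u \<in> cluster (edges G) v"
    then obtain k where "(v, u) \<in> arcs (edges G) ^^ k"
      using rtrancl_imp_relpow unfolding cluster_def by blast
    thus "u \<in> (\<Union>k. walk_ball (edges G) k v)" unfolding walk_ball_def by blast
  qed
  show "countable (\<Union>k. walk_ball (edges G) k v)"
    by (rule countable_UN) (auto intro: countable_finite finite_walk_ball[OF G(2)])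
qed

lemma connected_verts_eq_cluster:
  assumes "connected_graph G" "v \<in> verts G"
  shows "verts G = cluster (edges G) v"
  using assms simple_cluster_subset[OF G(1) assms(2) order_refl]
  unfolding connected_graph_def cluster_def adj_eq_arcs by auto

lemma infinite_component_sets:
  assumes "connected_graph G" "v \<in> verts G"
  shows "{\<omega> \<in> space (percolation G p). \<exists>C\<in>components_of (open_graph G \<omega>). infinite C}
           \<in> sets (percolation G p)"
  unfolding infinite_component_event
  using countable_cluster[of v] connected_verts_eq_cluster[OF assms]
  by (intro sets.countable_UN' image_subsetI infinite_cluster_sets) auto

lemma infinite_cluster_le_component:
  assumes "connected_graph G" "v \<in> verts G"
  shows "\<P>(\<omega> in percolation G p. infinite (cluster {e\<in>edges G. \<omega> e} v))
     \<le> \<P>(\<omega> in percolation G p. \<exists>C\<in>components_of (open_graph G \<omega>). infinite C)"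
proof -
  interpret prob_space "percolation G p" by (rule prob_space_percolation)
  show ?thesis
    by (rule finite_measure_mono[OF _ infinite_component_sets[OF assms]])
      (use assms(2) in \<open>auto simp: components_open_graph[OF G(1)]\<close>)
qed

lemma theta_subcritical:
  assumes conn: "connected_graph G" and v: "v \<in> verts G" and p: "0 \<le> p" "p \<le> 1" "p < p_crit G"
  shows "(\<lambda>k. theta (edges G) p k v) \<longlonglongrightarrow> 0"
proof -
  let ?X = "\<lambda>p. \<P>(\<omega> in percolation G p. \<exists>C\<in>components_of (open_graph G \<omega>). infinite C)"
  have "\<not> ?X p > 0"
  proof
    assume "?X p > 0"
    hence "Inf {p \<in> {0..1}. ?X p > 0} \<le> p"
      using p by (intro cInf_lower) (auto intro: bdd_belowI[of _ 0])
    thus False using p(3) unfolding p_crit_def by simp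
  qed
  hence "\<P>(\<omega> in percolation G p. infinite (cluster {e\<in>edges G. \<omega> e} v)) = 0"
    using infinite_cluster_le_component[OF conn v, of p] by (auto intro!: antisym)
  thus ?thesis using theta_tendsto[of p v] by simp
qed

text \<open>Some parameter \<open>p1 < p\<close> percolates with positive probability. The graph is countable, so some vertex
  \<open>v\<close> lies in an infinite cluster with positive probability, and a path from \<open>v\<close> to \<open>\<rho>\<close> moves this bound to
  \<open>\<rho>\<close>. The resulting \<open>\<delta>\<close> does not depend on \<open>k\<close>, which is what allows \<open>k\<close> to be chosen last.\<close>

lemma theta_supercritical:
  assumes conn: "connected_graph G" and inf: "infinite (verts G)" and \<rho>: "\<rho> \<in> verts G"
    and p: "p_crit G < p" "p \<le> 1"
  shows "\<exists>p1 \<delta>. 0 < p1 \<and> p1 < p \<and> 0 < \<delta> \<and> (\<forall>k. \<delta> \<le> theta (edges G) p1 k \<rho>)"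
proof -
  let ?X = "\<lambda>p. \<P>(\<omega> in percolation G p. \<exists>C\<in>components_of (open_graph G \<omega>). infinite C)"
  let ?I = "\<lambda>p v. \<P>(\<omega> in percolation G p. infinite (cluster {e\<in>edges G. \<omega> e} v))"
  have V: "verts G = cluster (edges G) \<rho>" by (rule connected_verts_eq_cluster[OF conn \<rho>])
  have "(\<lambda>k. theta (edges G) 1 k \<rho>) \<longlonglongrightarrow> 1" using theta_1[of \<rho>] inf V by simp
  hence "?I 1 \<rho> = 1" using theta_tendsto[of 1 \<rho>] LIMSEQ_unique by blast
  hence "?X 1 > 0" using infinite_cluster_le_component[OF conn \<rho>, of 1] by simp
  hence ne: "{p \<in> {0..1}. ?X p > 0} \<noteq> {}" by (intro ex_in_conv[THEN iffD1] exI[of _ 1]) simp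
  obtain p1 where p1: "0 \<le> p1" "p1 < p" "?X p1 > 0"
    using cInf_lessD[OF ne] p(1) unfolding p_crit_def by auto
  interpret prob_space "percolation G p1" by (rule prob_space_percolation)
  have "\<exists>v\<in>verts G. ?I p1 v > 0"
  proof (rule ccontr)
    assume "\<not> (\<exists>v\<in>verts G. ?I p1 v > 0)"
    hence z: "?I p1 v = 0" if "v \<in> verts G" for v
      using that measure_nonneg[of "percolation G p1"] by (auto simp: not_less intro: antisym)
    have "{\<omega> \<in> space (percolation G p1). \<exists>C\<in>components_of (open_graph G \<omega>). infinite C}
        \<in> null_sets (percolation G p1)"
      unfolding infinite_component_event
    proof (rule null_sets_UN')
      show "countable (verts G)" unfolding V by (rule countable_cluster)
      fix v assume "v \<in> verts G"
      thus "{\<omega> \<in> space (percolation G p1). infinite (cluster {e\<in>edges G. \<omega> e} v)} \<in> null_sets (percolation G p1)"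
        using z infinite_cluster_sets by (auto simp: null_sets_def emeasure_eq_measure)
    qed
    hence "?X p1 = 0" by (simp add: measure_eq_0_null_sets)
    thus False using p1(3) by simp
  qed
  then obtain v where v: "v \<in> verts G" "?I p1 v > 0" by blast
  have pos: "?I p1 v \<le> theta (edges G) p1 k v" for k by (rule infinite_cluster_le_theta)
  have "p1 \<noteq> 0" using pos[of 2] v(2) theta_0[of v] by auto
  hence p1pos: "0 < p1" using p1(1) by simp
  have "\<rho> \<in> cluster (edges G) v" using v(1) V cluster_sym[of v _ \<rho>] by auto
  then obtain c where c: "c > 0" "\<And>k. c * theta (edges G) p1 k v \<le> theta (edges G) p1 k \<rho>"
    using theta_cluster_le[of \<rho> v p1] p1pos p1(2) p(2) by auto
  have "c * ?I p1 v \<le> theta (edges G) p1 k \<rho>" for k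
    using mult_left_mono[OF pos[of k], of c] c(1) c(2)[of k] by linarith
  moreover have "0 < c * ?I p1 v" using c(1) v(2) by simp
  ultimately show ?thesis using p1pos p1(2) by blast
qed

end

section \<open>The number of vertices in big clusters\<close>

lemma expectation_card:
  assumes "finite V"
  shows "measure_pmf.expectation M (\<lambda>\<omega>. real (card {v\<in>V. Q v \<omega>})) = (\<Sum>v\<in>V. measure_pmf.prob M {\<omega>. Q v \<omega>})"
proof -
  have "real (card {v\<in>V. Q v \<omega>}) = (\<Sum>v\<in>V. indicator {\<omega>. Q v \<omega>} \<omega>)" for \<omega>
    using assms by (simp add: indicator_def sum.If_cases Int_def)
  moreover have "integrable M (indicator {\<omega>. Q v \<omega>} :: _ \<Rightarrow> real)" for v
    by (rule measure_pmf.integrable_const_bound[where B = 1]) (auto simp: indicator_def)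
  ultimately have "measure_pmf.expectation M (\<lambda>\<omega>. real (card {v\<in>V. Q v \<omega>}))
      = (\<Sum>v\<in>V. measure_pmf.expectation M (indicator {\<omega>. Q v \<omega>}))"
    by (simp add: Bochner_Integration.integral_sum)
  thus ?thesis by simp
qed

text \<open>Chebyshev's inequality for a number of occurring events, with the covariances summed row by row.\<close>

lemma second_moment_lower_tail:
  fixes M :: "'w pmf" and Q :: "'v \<Rightarrow> 'w \<Rightarrow> bool"
  assumes fin: "finite V" "finite (set_pmf M)" and t: "t > 0"
    and cov: "\<And>v. v \<in> V \<Longrightarrow> (\<Sum>w\<in>V. measure_pmf.prob M {\<omega>. Q v \<omega> \<and> Q w \<omega>}
        - measure_pmf.prob M {\<omega>. Q v \<omega>} * measure_pmf.prob M {\<omega>. Q w \<omega>}) \<le> D"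
  shows "measure_pmf.prob M {\<omega>. real (card {v\<in>V. Q v \<omega>}) \<le> (\<Sum>v\<in>V. measure_pmf.prob M {\<omega>. Q v \<omega>}) - t}
     \<le> real (card V) * D / t\<^sup>2"
proof -
  let ?E = "measure_pmf.expectation M"
  define X where "X v \<omega> = (indicator {\<omega>. Q v \<omega>} \<omega> :: real)" for v \<omega>
  define m where "m v = measure_pmf.prob M {\<omega>. Q v \<omega>}" for v
  define S where "S \<omega> = real (card {v\<in>V. Q v \<omega>})" for \<omega>
  have int [simp]: "integrable M g" for g :: "'w \<Rightarrow> real"
    by (rule integrable_measure_pmf_finite[OF fin(2)])
  have S: "S \<omega> = (\<Sum>v\<in>V. X v \<omega>)" for \<omega>
    using fin(1) by (simp add: S_def X_def indicator_def sum.If_cases Int_def)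
  have EX: "?E (X v) = m v" for v by (simp add: X_def[abs_def] m_def)
  have cov_eq: "?E (\<lambda>\<omega>. (X v \<omega> - m v) * (X w \<omega> - m w)) = measure_pmf.prob M {\<omega>. Q v \<omega> \<and> Q w \<omega>} - m v * m w" for v w
  proof -
    have "(X v \<omega> - m v) * (X w \<omega> - m w) = indicator {\<omega>. Q v \<omega> \<and> Q w \<omega>} \<omega> - m w * X v \<omega> - m v * X w \<omega> + m v * m w" for \<omega>
      by (auto simp: X_def indicator_def algebra_simps)
    hence "?E (\<lambda>\<omega>. (X v \<omega> - m v) * (X w \<omega> - m w))
       = ?E (\<lambda>\<omega>. indicator {\<omega>. Q v \<omega> \<and> Q w \<omega>} \<omega> - m w * X v \<omega> - m v * X w \<omega> + m v * m w)" by simp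
    also have "\<dots> = measure_pmf.prob M {\<omega>. Q v \<omega> \<and> Q w \<omega>} - m v * m w"
      by (simp add: EX)
    finally show ?thesis .
  qed
  have "(S \<omega> - (\<Sum>v\<in>V. m v))\<^sup>2 = (\<Sum>v\<in>V. \<Sum>w\<in>V. (X v \<omega> - m v) * (X w \<omega> - m w))" for \<omega>
    unfolding S power2_eq_square sum_subtractf[symmetric] sum_product ..
  hence "?E (\<lambda>\<omega>. (S \<omega> - (\<Sum>v\<in>V. m v))\<^sup>2) = (\<Sum>v\<in>V. \<Sum>w\<in>V. measure_pmf.prob M {\<omega>. Q v \<omega> \<and> Q w \<omega>} - m v * m w)"
    by (simp add: cov_eq)
  also have "\<dots> \<le> (\<Sum>v\<in>V. D)" unfolding m_def by (intro sum_mono cov)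
  finally have var: "?E (\<lambda>\<omega>. (S \<omega> - (\<Sum>v\<in>V. m v))\<^sup>2) \<le> real (card V) * D" by simp
  let ?A = "{\<omega>. S \<omega> \<le> (\<Sum>v\<in>V. m v) - t}"
  have "t\<^sup>2 * measure_pmf.prob M ?A = ?E (\<lambda>\<omega>. t\<^sup>2 * indicator ?A \<omega>)" by simp
  also have "\<dots> \<le> ?E (\<lambda>\<omega>. (S \<omega> - (\<Sum>v\<in>V. m v))\<^sup>2)"
  proof (rule integral_mono[OF int int])
    fix \<omega>
    show "t\<^sup>2 * indicator ?A \<omega> \<le> (S \<omega> - (\<Sum>v\<in>V. m v))\<^sup>2"
    proof (cases "\<omega> \<in> ?A")
      case True
      hence "t \<le> (\<Sum>v\<in>V. m v) - S \<omega>" by simp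
      hence "t\<^sup>2 \<le> ((\<Sum>v\<in>V. m v) - S \<omega>)\<^sup>2" using t by (intro power_mono) auto
      thus ?thesis using True by (simp add: power2_commute)
    qed simp
  qed
  finally have "t\<^sup>2 * measure_pmf.prob M ?A \<le> real (card V) * D" using var by simp
  thus ?thesis using t unfolding S_def m_def by (simp add: field_simps)
qed

lemma theta_le_1: "theta E p k v \<le> 1"
  unfolding theta_def by simp

lemma theta_nonneg: "0 \<le> theta E p k v"
  unfolding theta_def by simp

definition has_giant :: "'b ugraph \<Rightarrow> real \<Rightarrow> ('b set \<Rightarrow> bool) \<Rightarrow> bool" where
  "has_giant H \<alpha> \<omega> \<longleftrightarrow> (\<exists>v\<in>verts H. real (card (cluster {e\<in>edges H. \<omega> e} v)) \<ge> \<alpha> * real (card (verts H)))"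

lemma finite_edges:
  assumes "finite_graph G"
  shows "finite (edges G)"
proof (rule finite_subset)
  show "edges G \<subseteq> Pow (verts G)" using assms unfolding finite_graph_def simple_graph_def by fastforce
qed (use assms in \<open>simp add: finite_graph_def\<close>)

context
  fixes H :: "'b ugraph" and d :: nat
  assumes H: "finite_graph H" "degree_bound H d"
begin

lemma simple_of_finite: "simple_graph H" and finite_verts: "finite (verts H)" and card_verts_pos: "0 < card (verts H)"
  and bounded_deg_of_degree_bound: "bounded_deg (edges H) d" and finite_edges_of_finite: "finite (edges H)"
  using H bounded_deg_edges[of H d] finite_edges[of H] by (auto simp: finite_graph_def card_gt_0_iff)

lemma prob_large_component_eq:
  "prob_large_component H p \<alpha> = measure_pmf.prob (bond_perc (edges H) p) {\<omega>. has_giant H \<alpha> \<omega>}"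
proof -
  have "supported_on (edges H) (has_giant H \<alpha>)"
    unfolding supported_on_def
  proof (intro allI impI)
    fix \<omega> \<omega>' :: "'b set \<Rightarrow> bool" assume "\<forall>e\<in>edges H. \<omega> e = \<omega>' e"
    hence "{e\<in>edges H. \<omega> e} = {e\<in>edges H. \<omega>' e}" by auto
    thus "has_giant H \<alpha> \<omega> = has_giant H \<alpha> \<omega>'" by (simp add: has_giant_def)
  qed
  from percolation_finite_support(2)[OF finite_edges_of_finite order_refl this, of p] show ?thesis
    unfolding prob_large_component_def components_open_graph[OF simple_of_finite] has_giant_def by simp
qed

text \<open>Every vertex of a component with at least \<open>\<alpha>|H|\<close> vertices has a cluster of size at least \<open>k\<close>, so the
  existence of such a component forces at least \<open>\<alpha>|H|\<close> vertices with big clusters.\<close>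

lemma giant_markov:
  assumes \<alpha>: "\<alpha> > 0" and k: "real k \<le> \<alpha> * real (card (verts H))"
  shows "prob_large_component H p \<alpha> * (\<alpha> * real (card (verts H))) \<le> (\<Sum>v\<in>verts H. theta (edges H) p k v)"
proof -
  let ?M = "bond_perc (edges H) p" and ?a = "\<alpha> * real (card (verts H))"
  let ?N = "\<lambda>\<omega>. {v\<in>verts H. big {e\<in>edges H. \<omega> e} k v}"
  have int: "integrable ?M g" for g :: "_ \<Rightarrow> real"
    by (rule integrable_measure_pmf_finite[OF finite_set_bond_perc[OF finite_edges_of_finite]])
  have "prob_large_component H p \<alpha> * ?a = measure_pmf.expectation ?M (\<lambda>\<omega>. ?a * indicator {\<omega>. has_giant H \<alpha> \<omega>} \<omega>)"
    unfolding prob_large_component_eq by simp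
  also have "\<dots> \<le> measure_pmf.expectation ?M (\<lambda>\<omega>. real (card (?N \<omega>)))"
  proof (rule integral_mono[OF int int])
    fix \<omega>
    show "?a * indicator {\<omega>. has_giant H \<alpha> \<omega>} \<omega> \<le> real (card (?N \<omega>))"
    proof (cases "has_giant H \<alpha> \<omega>")
      case True
      let ?F = "{e\<in>edges H. \<omega> e}"
      obtain v where v: "v \<in> verts H" "?a \<le> real (card (cluster ?F v))"
        using True by (auto simp: has_giant_def)
      have "cluster ?F v \<subseteq> ?N \<omega>"
      proof
        fix u assume u: "u \<in> cluster ?F v"
        have "u \<in> verts H" using simple_cluster_subset[OF simple_of_finite v(1), of ?F] u by auto
        moreover have "k \<le> card (cluster ?F u)" using v(2) k cluster_eq[OF u] by simp
        ultimately show "u \<in> ?N \<omega>" by (simp add: big_iff_cluster[OF bounded_deg_open[OF bounded_deg_of_degree_bound]])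
      qed
      hence "card (cluster ?F v) \<le> card (?N \<omega>)" using finite_verts by (intro card_mono) auto
      thus ?thesis using v(2) True by simp
    qed simp
  qed
  also have "\<dots> = (\<Sum>v\<in>verts H. theta (edges H) p k v)"
    by (simp add: expectation_card[OF finite_verts] prob_big_eq_theta[OF finite_edges_of_finite])
  finally show ?thesis .
qed

text \<open>The events for \<open>v\<close> and \<open>w\<close> are independent unless their balls of radius \<open>k\<close> share an edge, and then \<open>w\<close>
  is within distance \<open>2 k\<close> of \<open>v\<close>. Each row of covariances thus has a number of nonzero entries that is
  bounded independently of the size of the graph.\<close>

lemma big_vertices_lower_tail:
  assumes t: "t > 0"
  shows "measure_pmf.prob (bond_perc (edges H) p)
      {\<omega>. real (card {v\<in>verts H. big {e\<in>edges H. \<omega> e} k v}) \<le> (\<Sum>v\<in>verts H. theta (edges H) p k v) - t}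
     \<le> real (card (verts H)) * real ((d + 1) ^ (k + k)) / t\<^sup>2"
proof -
  let ?M = "bond_perc (edges H) p" and ?E = "edges H"
  let ?P = "\<lambda>Q. measure_pmf.prob ?M {\<omega>. Q \<omega>}"
  let ?Q = "\<lambda>v \<omega>. big {e\<in>?E. \<omega> e} k v"
  have cov: "(\<Sum>w\<in>verts H. ?P (\<lambda>\<omega>. ?Q v \<omega> \<and> ?Q w \<omega>) - ?P (?Q v) * ?P (?Q w)) \<le> real ((d + 1) ^ (k + k))"
    if v: "v \<in> verts H" for v
  proof -
    have "?P (\<lambda>\<omega>. ?Q v \<omega> \<and> ?Q w \<omega>) - ?P (?Q v) * ?P (?Q w) \<le> indicator (walk_ball ?E (k + k) v) w" for w
    proof (cases "ball_edges ?E k v \<inter> ball_edges ?E k w = {}")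
      case True
      show ?thesis
        by (subst bond_perc_indep[OF finite_edges_of_finite True ball_edges_subset ball_edges_subset supported_on_big supported_on_big]) simp
    next
      case False
      then obtain e where e: "e \<in> ball_edges ?E k v" "e \<in> ball_edges ?E k w" by blast
      hence "e \<in> ?E" by (simp add: ball_edges_def)
      then obtain x where "x \<in> e" using simple_of_finite unfolding simple_graph_def by blast
      hence x: "x \<in> walk_ball ?E k v" "x \<in> walk_ball ?E k w" using e by (auto simp: ball_edges_def)
      hence "w \<in> walk_ball ?E (k + k) v" using walk_ball_trans[OF x(1)] walk_ball_sym[of x ?E k w] by blast
      hence "indicator (walk_ball ?E (k + k) v) w = (1 :: real)" by simp
      moreover have "?P (\<lambda>\<omega>. ?Q v \<omega> \<and> ?Q w \<omega>) \<le> 1" by simp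
      moreover have "0 \<le> ?P (?Q v) * ?P (?Q w)" by simp
      ultimately show ?thesis by linarith
    qed
    hence "(\<Sum>w\<in>verts H. ?P (\<lambda>\<omega>. ?Q v \<omega> \<and> ?Q w \<omega>) - ?P (?Q v) * ?P (?Q w))
        \<le> (\<Sum>w\<in>verts H. indicator (walk_ball ?E (k + k) v) w)" by (rule sum_mono)
    also have "\<dots> = real (card (verts H \<inter> walk_ball ?E (k + k) v))"
      using finite_verts by (simp add: indicator_def sum.If_cases Int_def)
    also have "\<dots> \<le> real (card (walk_ball ?E (k + k) v))"
      using finite_walk_ball[OF bounded_deg_of_degree_bound] by (intro of_nat_mono card_mono) auto
    also have "\<dots> \<le> real ((d + 1) ^ (k + k))"
      by (intro of_nat_mono card_walk_ball_le[OF bounded_deg_of_degree_bound])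
    finally show ?thesis .
  qed
  from second_moment_lower_tail[OF finite_verts finite_set_bond_perc[OF finite_edges_of_finite] t cov]
  show ?thesis by (simp only: prob_big_eq_theta[OF finite_edges_of_finite])
qed

end

section \<open>Short edge-disjoint connections in expanders\<close>

definition reach :: "'a set set \<Rightarrow> nat \<Rightarrow> 'a set \<Rightarrow> 'a set" where
  "reach E k A = (\<Union>v\<in>A. walk_ball E k v)"

lemma reach_0 [simp]: "reach E 0 A = A"
  by (simp add: reach_def)

lemma reach_Suc: "reach E (Suc k) A = reach E k A \<union> {w. \<exists>u\<in>reach E k A. {u, w} \<in> E}"
  by (auto simp: reach_def walk_ball_Suc)

lemma walk_edge_set:
  assumes "(u, w) \<in> arcs E ^^ j"
  shows "\<exists>F\<subseteq>E. finite F \<and> card F \<le> j \<and> w \<in> cluster F u"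
  using assms
proof (induction j arbitrary: w)
  case 0
  thus ?case by (intro exI[of _ "{}"]) auto
next
  case (Suc j)
  then obtain x where x: "(u, x) \<in> arcs E ^^ j" "(x, w) \<in> arcs E" by auto
  then obtain F where F: "F \<subseteq> E" "finite F" "card F \<le> j" "x \<in> cluster F u" using Suc.IH by blast
  let ?F = "insert {x, w} F"
  have "x \<in> cluster ?F u" using F(4) cluster_mono[of F ?F u] by auto
  hence "(u, x) \<in> (arcs ?F)\<^sup>*" by (simp add: cluster_def)
  moreover have "(x, w) \<in> arcs ?F" by (simp add: arcs_def)
  ultimately have "w \<in> cluster ?F u" by (simp add: cluster_def rtrancl.rtrancl_into_rtrancl)
  moreover have "card ?F \<le> Suc j" using F(2,3) by (simp add: card_insert_if)
  ultimately show ?case using F(1,2) x(2) by (intro exI[of _ ?F]) (auto simp: arcs_def)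
qed

lemma cheeger_boundary:
  assumes "cheeger G \<ge> ereal h" "A \<subseteq> verts G" "0 < card A" "real (card A) \<le> real (card (verts G)) / 2"
  shows "h * real (card A) \<le> real (card (edges_between G A (verts G - A)))"
proof -
  have "ereal h \<le> ereal (real (card (edges_between G A (verts G - A))) / real (card A))"
    by (rule order_trans[OF assms(1)], unfold cheeger_def, rule INF_lower) (use assms in auto)
  thus ?thesis using assms(3) by (simp add: field_simps)
qed

context
  fixes G :: "'b ugraph" and d :: nat and h \<beta> :: real
  assumes G: "finite_graph G" "degree_bound G d" and h: "h > 0" "cheeger G \<ge> ereal h"
    and \<beta>: "\<beta> > 0"
begin

lemma reach_subset_verts: "F \<subseteq> edges G \<Longrightarrow> A \<subseteq> verts G \<Longrightarrow> reach F k A \<subseteq> verts G"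
proof
  fix w assume F: "F \<subseteq> edges G" and A: "A \<subseteq> verts G" and "w \<in> reach F k A"
  then obtain v where v: "v \<in> A" "w \<in> walk_ball F k v" by (auto simp: reach_def)
  have sG: "simple_graph G" using G(1) by (simp add: finite_graph_def)
  have "v \<in> verts G" using v A by blast
  from simple_cluster_subset[OF sG this F] show "w \<in> verts G"
    using v(2) walk_ball_subset_cluster[of F k v] by blast
qed

text \<open>The boundary of a set \<open>R\<close> containing \<open>A\<close> has at least \<open>h |R|\<close> edges, of which the deleted set \<open>U\<close> takes at
  most half. The remaining ones lead to new vertices, each of which absorbs at most \<open>d\<close> of them. The
  denominator uses \<open>d + 1\<close> to stay positive.\<close>

lemma reach_growth:
  assumes U: "U \<subseteq> edges G" "real (card U) \<le> h * \<beta> * real (card (verts G)) / 2"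
    and A: "A \<subseteq> verts G" "real (card A) \<ge> \<beta> * real (card (verts G))"
    and half: "real (card (reach (edges G - U) k A)) \<le> real (card (verts G)) / 2"
  shows "(1 + h / (2 * real (d + 1))) * real (card (reach (edges G - U) k A))
           \<le> real (card (reach (edges G - U) (Suc k) A))"
proof -
  let ?F = "edges G - U"
  let ?n = "real (card (verts G))"
  define R where "R = reach ?F k A"
  define S where "S = reach ?F (Suc k) A"
  have fin: "finite (verts G)" using G(1) by (simp add: finite_graph_def)
  have npos: "?n > 0" using G(1) by (simp add: finite_graph_def card_gt_0_iff)
  have RS: "R \<subseteq> verts G" "S \<subseteq> verts G" unfolding R_def S_def by (auto intro!: reach_subset_verts A(1) del: subsetI)
  have finRS: "finite R" "finite S" using RS fin by (auto intro: finite_subset)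
  have sub: "R \<subseteq> S" unfolding R_def S_def reach_Suc by blast
  have AR: "A \<subseteq> R" unfolding R_def reach_def by auto
  have "card A \<le> card R" using finRS(1) AR by (rule card_mono)
  hence \<beta>R: "\<beta> * ?n \<le> real (card R)" using A(2) by linarith
  moreover have "0 < \<beta> * ?n" using \<beta> npos by simp
  ultimately have Rpos: "0 < card R" by linarith
  let ?B = "edges_between G R (verts G - R)"
  have finB: "finite ?B" using finite_edges[OF G(1)] by (auto simp: edges_between_def)
  have "h * real (card R) \<le> real (card ?B)"
    by (rule cheeger_boundary[OF h(2) RS(1) Rpos]) (use half R_def in simp)
  moreover have "card ?B \<le> card U + card (?B - U)"
    using card_Un_le[of U "?B - U"] card_mono[of "U \<union> (?B - U)" ?B] finB finite_subset[OF U(1) finite_edges[OF G(1)]]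
    by fastforce
  moreover have "card (?B - U) \<le> card (S - R) * d"
  proof -
    have "?B - U \<subseteq> (\<Union>w\<in>S - R. {e\<in>edges G. w \<in> e})"
    proof
      fix e assume e: "e \<in> ?B - U"
      then obtain u w where uw: "u \<in> R" "w \<in> verts G - R" "e = {u, w}" "e \<in> edges G"
        by (auto simp: edges_between_def)
      have "w \<in> S" using uw e unfolding S_def reach_Suc R_def[symmetric] by blast
      thus "e \<in> (\<Union>w\<in>S - R. {e\<in>edges G. w \<in> e})" using uw by auto
    qed
    hence "card (?B - U) \<le> card (\<Union>w\<in>S - R. {e\<in>edges G. w \<in> e})"
      using finite_edges[OF G(1)] finRS by (intro card_mono) auto
    also have "\<dots> \<le> (\<Sum>w\<in>S - R. card {e\<in>edges G. w \<in> e})"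
      using finRS by (intro card_UN_le) auto
    also have "\<dots> \<le> (\<Sum>w\<in>S - R. d)"
      using G(2) RS by (intro sum_mono) (auto simp: degree_bound_def)
    finally show ?thesis by simp
  qed
  moreover have "h * \<beta> * ?n / 2 \<le> h * real (card R) / 2" using \<beta>R h(1) by simp
  ultimately have "h * real (card R) / 2 \<le> real (card (S - R) * d)" using U(2) by linarith
  also have "\<dots> \<le> real (card (S - R)) * real (d + 1)" by (simp add: algebra_simps)
  finally have "h / (2 * real (d + 1)) * real (card R) \<le> real (card (S - R))"
    by (simp add: field_simps)
  moreover have "card S = card R + card (S - R)"
    using sub finRS by (metis card_Diff_subset card_mono le_add_diff_inverse)
  ultimately show ?thesis unfolding R_def[symmetric] S_def[symmetric] by (simp add: algebra_simps)
qed

text \<open>Geometric growth can only stop at half of the vertices.\<close>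

lemma reach_majority:
  assumes U: "U \<subseteq> edges G" "real (card U) \<le> h * \<beta> * real (card (verts G)) / 2"
    and A: "A \<subseteq> verts G" "real (card A) \<ge> \<beta> * real (card (verts G))"
    and r: "(1 + h / (2 * real (d + 1))) ^ r * \<beta> > 1 / 2"
  shows "real (card (reach (edges G - U) r A)) > real (card (verts G)) / 2"
proof (rule ccontr)
  let ?R = "\<lambda>k. reach (edges G - U) k A" and ?n = "real (card (verts G))"
  let ?c = "1 + h / (2 * real (d + 1))"
  assume "\<not> ?thesis"
  hence half: "real (card (?R r)) \<le> ?n / 2" by simp
  have fin: "finite (verts G)" using G(1) by (simp add: finite_graph_def)
  have npos: "?n > 0" using G(1) by (simp add: finite_graph_def card_gt_0_iff)
  have finR: "finite (?R k)" for k by (rule finite_subset[OF reach_subset_verts[OF Diff_subset A(1)] fin])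
  have mono: "?R k \<subseteq> ?R r" if "k \<le> r" for k
    unfolding reach_def by (intro UN_mono walk_ball_mono_radius that order_refl)
  have "?c ^ k * (\<beta> * ?n) \<le> real (card (?R k))" if "k \<le> r" for k
    using that
  proof (induction k)
    case (Suc k)
    have "card (?R k) \<le> card (?R r)" using mono[of k] Suc.prems finR by (intro card_mono) auto
    hence "?c * real (card (?R k)) \<le> real (card (?R (Suc k)))"
      using half by (intro reach_growth[OF U A]) linarith
    moreover have "?c * (?c ^ k * (\<beta> * ?n)) \<le> ?c * real (card (?R k))"
      using Suc h(1) by (intro mult_left_mono) auto
    ultimately show ?case by (simp add: mult.assoc)
  qed (use A(2) in simp)
  from this[of r] have "?c ^ r * \<beta> * ?n \<le> real (card (?R r))" by (simp add: mult.assoc)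
  moreover have "1 / 2 * ?n < ?c ^ r * \<beta> * ?n" using r npos by (rule mult_strict_right_mono)
  ultimately show False using half by simp
qed

text \<open>Two sets that each contain more than half of the vertices intersect, so that the neighbourhoods of radius
  \<open>r\<close> about \<open>A\<close> and \<open>B\<close> meet even after the edges in \<open>U\<close> are deleted.\<close>

lemma short_connection:
  assumes U: "U \<subseteq> edges G" "real (card U) \<le> h * \<beta> * real (card (verts G)) / 2"
    and A: "A \<subseteq> verts G" "real (card A) \<ge> \<beta> * real (card (verts G))"
    and B: "B \<subseteq> verts G" "real (card B) \<ge> \<beta> * real (card (verts G))"
    and r: "(1 + h / (2 * real (d + 1))) ^ r * \<beta> > 1 / 2"
  shows "\<exists>F\<subseteq>edges G - U. finite F \<and> card F \<le> 2 * r \<and> (\<exists>a\<in>A. \<exists>b\<in>B. b \<in> cluster F a)"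
proof -
  let ?E = "edges G - U"
  have fin: "finite (verts G)" using G(1) by (simp add: finite_graph_def)
  have sub: "reach ?E r A \<subseteq> verts G" "reach ?E r B \<subseteq> verts G"
    by (auto intro!: reach_subset_verts A(1) B(1) del: subsetI)
  have "reach ?E r A \<inter> reach ?E r B \<noteq> {}"
  proof
    assume e: "reach ?E r A \<inter> reach ?E r B = {}"
    have "card (reach ?E r A) + card (reach ?E r B) = card (reach ?E r A \<union> reach ?E r B)"
      by (rule card_Un_disjoint[symmetric]) (use sub fin e in \<open>auto intro: finite_subset\<close>)
    also have "\<dots> \<le> card (verts G)" using sub fin by (intro card_mono) auto
    finally show False using reach_majority[OF U A r] reach_majority[OF U B r] by linarith
  qed
  then obtain a b x where x: "a \<in> A" "b \<in> B" "x \<in> walk_ball ?E r a" "x \<in> walk_ball ?E r b"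
    by (auto simp: reach_def)
  have "b \<in> walk_ball ?E (r + r) a" using walk_ball_trans[OF x(3)] x(4) walk_ball_sym[of x ?E r b] by auto
  then obtain j where "j \<le> r + r" "(a, b) \<in> arcs ?E ^^ j" by (auto simp: walk_ball_def)
  then obtain F where "F \<subseteq> ?E" "finite F" "card F \<le> j" "b \<in> cluster F a" using walk_edge_set by metis
  moreover have "card F \<le> 2 * r" using \<open>card F \<le> j\<close> \<open>j \<le> r + r\<close> by simp
  ultimately show ?thesis using x(1,2) by blast
qed

text \<open>A substitute for Menger's theorem. Take a family of disjoint short connections of maximal cardinality; if
  it were smaller than claimed, its edges would be few enough to be deleted in \<open>short_connection\<close>, which
  would supply one more connection.\<close>

lemma many_disjoint_connections:
  assumes A: "A \<subseteq> verts G" "real (card A) \<ge> \<beta> * real (card (verts G))"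
    and B: "B \<subseteq> verts G" "real (card B) \<ge> \<beta> * real (card (verts G))" and AB: "A \<inter> B = {}"
    and r: "(1 + h / (2 * real (d + 1))) ^ r * \<beta> > 1 / 2" "L \<ge> 2 * r" "L > 0"
  shows "\<exists>\<F>. finite \<F> \<and> disjoint \<F> \<and>
     (\<forall>F\<in>\<F>. F \<subseteq> edges G \<and> card F \<le> L \<and> (\<exists>a\<in>A. \<exists>b\<in>B. b \<in> cluster F a)) \<and>
     real (card \<F>) \<ge> h * \<beta> / (2 * real L) * real (card (verts G))"
proof -
  define P where "P \<F> \<longleftrightarrow> disjoint \<F> \<and> (\<forall>F\<in>\<F>. F \<subseteq> edges G \<and> card F \<le> L \<and> (\<exists>a\<in>A. \<exists>b\<in>B. b \<in> cluster F a))" for \<F>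
  have Ppow: "{\<F>. P \<F>} \<subseteq> Pow (Pow (edges G))" by (auto simp: P_def)
  have finP: "finite {\<F>. P \<F>}" by (rule finite_subset[OF Ppow]) (simp add: finite_edges[OF G(1)])
  have "P {}" by (simp add: P_def)
  hence ne: "{\<F>. P \<F>} \<noteq> {}" by blast
  obtain \<F> where F: "P \<F>" "\<And>\<F>'. P \<F>' \<Longrightarrow> card \<F>' \<le> card \<F>"
  proof -
    have "Max (card ` {\<F>. P \<F>}) \<in> card ` {\<F>. P \<F>}" using finP ne by (intro Max_in) auto
    then obtain \<F> where "P \<F>" "card \<F> = Max (card ` {\<F>. P \<F>})" by auto
    thus ?thesis using finP by (intro that[of \<F>]) auto
  qed
  have Fpow: "\<F> \<subseteq> Pow (edges G)" using F(1) Ppow by auto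
  hence finF: "finite \<F>" by (rule finite_subset) (simp add: finite_edges[OF G(1)])
  have "real (card \<F>) \<ge> h * \<beta> / (2 * real L) * real (card (verts G))"
  proof (rule ccontr)
    assume "\<not> ?thesis"
    hence small: "real (card \<F>) * real L \<le> h * \<beta> * real (card (verts G)) / 2"
      using r(3) by (simp add: field_simps)
    have "card (\<Union>\<F>) \<le> (\<Sum>F\<in>\<F>. card F)" by (rule card_Union_le_sum_card)
    also have "\<dots> \<le> (\<Sum>F\<in>\<F>. L)" using F(1) by (intro sum_mono) (auto simp: P_def)
    finally have "real (card (\<Union>\<F>)) \<le> real (card \<F>) * real L" by (metis of_nat_le_iff of_nat_mult sum_constant of_nat_id)
    hence U: "real (card (\<Union>\<F>)) \<le> h * \<beta> * real (card (verts G)) / 2" using small by linarith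
    have "\<Union>\<F> \<subseteq> edges G" using Fpow by auto
    from short_connection[OF this U A B r(1)] obtain F a b where
      c: "F \<subseteq> edges G - \<Union>\<F>" "finite F" "card F \<le> 2 * r" "a \<in> A" "b \<in> B" "b \<in> cluster F a" by blast
    (* Disjointness from the family makes F a new member only because it is nonempty. *)
    have "F \<noteq> {}"
    proof
      assume "F = {}"
      hence "b = a" using c(6) by (simp add: cluster_def arcs_def)
      thus False using c(4,5) AB by auto
    qed
    hence new: "F \<notin> \<F>" using c(1) by auto
    have "disjoint (insert F \<F>)"
      using F(1) c(1) unfolding P_def by (auto simp: disjoint_def)
    moreover have "card F \<le> L" using c(3) r(2) by simp
    ultimately have "P (insert F \<F>)" using F(1) c unfolding P_def by blast
    from F(2)[OF this] show False using new finF by simp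
  qed
  thus ?thesis using F(1) finF unfolding P_def by blast
qed

end

section \<open>Sprinkling\<close>

definition saturated :: "'a set set \<Rightarrow> 'a set \<Rightarrow> bool" where
  "saturated F A \<longleftrightarrow> (\<forall>v\<in>A. cluster F v \<subseteq> A)"

lemma saturated_Diff_cluster:
  assumes "saturated F S"
  shows "saturated F (S - cluster F v)"
  unfolding saturated_def
proof (intro ballI subsetI)
  fix u w assume u: "u \<in> S - cluster F v" and w: "w \<in> cluster F u"
  have "w \<notin> cluster F v"
  proof
    assume "w \<in> cluster F v"
    hence "cluster F v = cluster F u" using cluster_eq[of w F v] cluster_eq[OF w] by simp
    thus False using u cluster_self[of u F] by simp
  qed
  thus "w \<in> S - cluster F v" using assms u w unfolding saturated_def by blast
qed

text \<open>Take a union \<open>S\<close> of clusters that is minimal among those containing at least \<open>a\<close> elements of \<open>W\<close>. Removing one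
  cluster drops the count below \<open>a\<close>, and that cluster has fewer than \<open>a\<close> elements, so \<open>S\<close> contains fewer than
  \<open>2 a\<close> of the \<open>3 a\<close> elements of \<open>W\<close>.\<close>

lemma saturated_halving:
  fixes a :: real
  assumes V: "finite V" "saturated F V" and small: "\<And>v. v \<in> V \<Longrightarrow> real (card (cluster F v)) < a"
    and W: "W \<subseteq> V" "3 * a \<le> real (card W)" and a: "a > 0"
  shows "\<exists>S\<subseteq>V. saturated F S \<and> a \<le> real (card (W \<inter> S)) \<and> a \<le> real (card (W - S))"
proof -
  define P where "P S \<longleftrightarrow> S \<subseteq> V \<and> saturated F S \<and> a \<le> real (card (W \<inter> S))" for S
  have finW: "finite W" using W V by (auto intro: finite_subset)
  have "W \<inter> V = W" using W(1) by auto
  hence "P V" using V(2) W a by (simp add: P_def)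
  then obtain S where S: "P S" and min: "\<And>S'. P S' \<Longrightarrow> card S \<le> card S'"
    using exists_least_iff[of "\<lambda>m. \<exists>S. P S \<and> card S = m"] by (metis not_le)
  have "W \<inter> S \<noteq> {}" using S a by (auto simp: P_def)
  then obtain v where v: "v \<in> S" "v \<in> V" using W(1) by auto
  let ?S' = "S - cluster F v"
  have finS: "finite S" using S V(1) by (auto simp: P_def intro: finite_subset)
  have clfin: "finite (cluster F v)"
    using V v(2) unfolding saturated_def by (auto intro: finite_subset)
  have "card ?S' < card S" 
  proof (rule psubset_card_mono[OF finS])
    have "v \<notin> ?S'" by simp
    thus "?S' \<subset> S" using v(1) by blast
  qed
  hence "\<not> P ?S'" using min[of ?S'] by auto
  moreover have "saturated F ?S'" using S by (intro saturated_Diff_cluster) (simp add: P_def)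
  ultimately have "real (card (W \<inter> ?S')) < a" using S by (auto simp: P_def)
  moreover have "card (W \<inter> S) \<le> card (W \<inter> ?S') + card (cluster F v)"
  proof -
    have "card (W \<inter> S) \<le> card ((W \<inter> ?S') \<union> cluster F v)"
      using finW clfin by (intro card_mono) auto
    also have "\<dots> \<le> card (W \<inter> ?S') + card (cluster F v)" by (rule card_Un_le)
    finally show ?thesis .
  qed
  ultimately have "real (card (W \<inter> S)) < 2 * a" using small[OF v(2)] by linarith
  moreover have "card W = card (W \<inter> S) + card (W - S)"
    using finW by (metis card_Int_Diff)
  ultimately have "a \<le> real (card (W - S))" using W(2) by linarith
  thus ?thesis using S by (auto simp: P_def)
qed

text \<open>A saturated subset of \<open>W\<close> is determined by the clusters that it contains, and disjoint clusters of size at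
  least \<open>k\<close> number at most \<open>|V|/k\<close>. This is where large \<open>k\<close> makes the union bound cheap.\<close>

lemma card_saturated_subsets:
  assumes V: "finite V" "W \<subseteq> V" and k: "\<And>v. v \<in> W \<Longrightarrow> cluster F v \<subseteq> V \<and> k \<le> card (cluster F v)"
  shows "\<exists>m. card {A. A \<subseteq> W \<and> saturated F A} \<le> 2 ^ m \<and> m * k \<le> card V"
proof -
  define K where "K = cluster F ` W"
  have finW: "finite W" using V by (auto intro: finite_subset)
  have finK: "finite K" using finW by (simp add: K_def)
  have disj: "pairwise disjnt K"
    unfolding K_def pairwise_def disjnt_def
  proof (intro ballI impI)
    fix X Y assume XY: "X \<in> cluster F ` W" "Y \<in> cluster F ` W" "X \<noteq> Y"
    then obtain u v where uv: "X = cluster F u" "Y = cluster F v" by auto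
    show "X \<inter> Y = {}"
    proof (rule ccontr)
      assume "X \<inter> Y \<noteq> {}"
      then obtain w where "w \<in> cluster F u" "w \<in> cluster F v" using uv by auto
      hence "X = Y" using cluster_eq[of w F u] cluster_eq[of w F v] uv by simp
      thus False using XY(3) by simp
    qed
  qed
  have KV: "\<Union>K \<subseteq> V" using k by (auto simp: K_def)
  have "card K * k = (\<Sum>X\<in>K. k)" by simp
  also have "\<dots> \<le> (\<Sum>X\<in>K. card X)" using k by (intro sum_mono) (auto simp: K_def)
  also have "\<dots> = card (\<Union>K)"
    by (rule card_Union_disjoint[symmetric, OF disj]) (use KV V(1) in \<open>auto intro: finite_subset\<close>)
  also have "\<dots> \<le> card V" using KV V(1) by (intro card_mono)
  finally have 1: "card K * k \<le> card V" .
  have "{A. A \<subseteq> W \<and> saturated F A} \<subseteq> Union ` Pow K"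
  proof
    fix A assume A: "A \<in> {A. A \<subseteq> W \<and> saturated F A}"
    have "A = \<Union>(cluster F ` A)" using A by (auto simp: saturated_def)
    moreover have "cluster F ` A \<in> Pow K" using A by (auto simp: K_def)
    ultimately show "A \<in> Union ` Pow K" by blast
  qed
  hence "card {A. A \<subseteq> W \<and> saturated F A} \<le> card (Union ` Pow K)"
    using finK by (intro card_mono) auto
  also have "\<dots> \<le> card (Pow K)" using finK by (intro card_image_le) auto
  also have "\<dots> = 2 ^ card K" using finK by (simp add: card_Pow)
  finally show ?thesis using 1 by blast
qed

lemma prob_bind_le:
  assumes "\<And>x. x \<in> set_pmf M \<Longrightarrow> \<not> B x \<Longrightarrow> measure_pmf.prob (K x) A \<le> \<epsilon>" "0 \<le> \<epsilon>"
  shows "measure_pmf.prob (bind_pmf M K) A \<le> measure_pmf.prob M {x. B x} + \<epsilon>"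
proof -
  have "emeasure (bind_pmf M K) A = (\<integral>\<^sup>+x. emeasure (K x) A \<partial>M)" by simp
  also have "\<dots> \<le> (\<integral>\<^sup>+x. indicator {x. B x} x + ennreal \<epsilon> \<partial>M)"
  proof (rule nn_integral_mono_AE, simp add: AE_measure_pmf_iff, intro ballI)
    fix x assume x: "x \<in> set_pmf M"
    show "emeasure (K x) A \<le> indicator {x. B x} x + ennreal \<epsilon>"
    proof (cases "B x")
      case True
      thus ?thesis using measure_pmf.emeasure_le_1[of "K x" A] by (simp add: add_increasing2)
    next
      case False
      thus ?thesis using assms(1)[OF x] by (simp add: measure_pmf.emeasure_eq_measure ennreal_leI)
    qed
  qed
  also have "\<dots> = ennreal (measure_pmf.prob M {x. B x} + \<epsilon>)"
    using assms(2) by (simp add: nn_integral_add measure_pmf.emeasure_eq_measure)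
  finally show ?thesis
    using assms(2) by (simp add: measure_pmf.emeasure_eq_measure del: ennreal_plus)
qed

context
  fixes H :: "'b ugraph" and d :: nat and h \<alpha> :: real
  assumes H: "finite_graph H" "degree_bound H d" and h: "h > 0" "cheeger H \<ge> ereal h"
    and \<alpha>: "\<alpha> > 0"
begin

lemma saturated_verts: "F \<subseteq> edges H \<Longrightarrow> saturated F (verts H)"
  unfolding saturated_def using simple_cluster_subset[OF simple_of_finite[OF H]] by blast

text \<open>The configuration \<open>f\<close> of the first percolation is fixed and \<open>W\<close> is the set of vertices in its big clusters.
  Failure of the sprinkling yields a division of \<open>W\<close> into two saturated parts that stay unconnected, and the
  bound is the number of divisions times the probability that a given one survives.\<close>

lemma sprinkling_fails:
  fixes f :: "'b set \<Rightarrow> bool" and q :: real and k r L :: nat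
  defines "W \<equiv> {v\<in>verts H. big {e\<in>edges H. f e} k v}"
  assumes W: "3 * (\<alpha> * real (card (verts H))) \<le> real (card W)" and k: "k > 0" and q: "0 \<le> q" "q \<le> 1"
    and r: "(1 + h / (2 * real (d + 1))) ^ r * \<alpha> > 1 / 2" "L \<ge> 2 * r" "L > 0"
  shows "measure_pmf.prob (bond_perc (edges H) q) {g. \<not> has_giant H \<alpha> (\<lambda>e. f e \<or> g e)}
     \<le> exp (real (card (verts H)) * (1 / real k - q ^ L * (h * \<alpha> / (2 * real L))))"
proof -
  let ?V = "verts H" and ?E = "edges H" and ?n = "real (card (verts H))"
  let ?F = "{e\<in>edges H. f e}" and ?c = "h * \<alpha> / (2 * real L)"
  let ?P = "\<lambda>X. measure_pmf.prob (bond_perc ?E q) X"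
  note Hs = simple_of_finite[OF H] finite_verts[OF H] card_verts_pos[OF H] bounded_deg_of_degree_bound[OF H] finite_edges_of_finite[OF H]
  define \<A> where "\<A> = {A. A \<subseteq> W \<and> saturated ?F A}"
  define \<A>' where "\<A>' = {A\<in>\<A>. \<alpha> * ?n \<le> real (card A) \<and> \<alpha> * ?n \<le> real (card (W - A))}"
  (* The sprinkled edges that leave the division into A and W - A unconnected. *)
  define cut where "cut A = {g. \<forall>a\<in>A. \<forall>b\<in>W - A. b \<notin> cluster {e\<in>?E. f e \<or> g e} a}" for A
  have WV: "W \<subseteq> ?V" by (auto simp: W_def)
  have finW: "finite W" using WV Hs(2) by (rule finite_subset)
  have big_W: "cluster ?F v \<subseteq> ?V \<and> k \<le> card (cluster ?F v)" if "v \<in> W" for v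
  proof -
    have v: "v \<in> ?V" "big ?F k v" using that by (auto simp: W_def)
    have sub: "cluster ?F v \<subseteq> ?V" by (rule simple_cluster_subset[OF Hs(1) v(1)]) auto
    hence "finite (cluster ?F v)" using Hs(2) by (rule finite_subset)
    thus ?thesis using v(2) big_iff_cluster[OF bounded_deg_open[OF Hs(4)]] sub by blast
  qed
  obtain m where m: "card \<A> \<le> 2 ^ m" "m * k \<le> card ?V"
    using card_saturated_subsets[OF Hs(2) WV big_W] unfolding \<A>_def by blast
  have fin\<A>: "finite \<A>" unfolding \<A>_def using finW by auto
  hence fin\<A>': "finite \<A>'" unfolding \<A>'_def by auto
  have satW: "saturated ?F W"
    unfolding saturated_def
  proof (intro ballI subsetI)
    fix v u assume v: "v \<in> W" and u: "u \<in> cluster ?F v"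
    have "u \<in> ?V" using big_W[OF v] u by auto
    moreover have "big ?F k u"
      using v cluster_eq[OF u] by (simp add: W_def big_iff_cluster[OF bounded_deg_open[OF Hs(4)]])
    ultimately show "u \<in> W" by (simp add: W_def)
  qed
  have "{g. \<not> has_giant H \<alpha> (\<lambda>e. f e \<or> g e)} \<subseteq> (\<Union>A\<in>\<A>'. cut A)"
  proof
    fix g assume g: "g \<in> {g. \<not> has_giant H \<alpha> (\<lambda>e. f e \<or> g e)}"
    let ?O = "{e\<in>?E. f e \<or> g e}"
    have small: "real (card (cluster ?O v)) < \<alpha> * ?n" if "v \<in> ?V" for v
      using g that by (auto simp: has_giant_def not_le)
    obtain S where S: "S \<subseteq> ?V" "saturated ?O S" "\<alpha> * ?n \<le> real (card (W \<inter> S))" "\<alpha> * ?n \<le> real (card (W - S))"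
      using saturated_halving[OF Hs(2) saturated_verts small WV W] \<alpha> Hs(3) by auto
    have FO: "cluster ?F v \<subseteq> cluster ?O v" for v by (rule cluster_mono) auto
    have "saturated ?F (W \<inter> S)"
      using satW S(2) FO unfolding saturated_def by blast
    hence "W \<inter> S \<in> \<A>'" using S by (simp add: \<A>'_def \<A>_def Diff_Int2 Diff_Int)
    moreover have "g \<in> cut (W \<inter> S)" using S(2) unfolding cut_def saturated_def by blast
    ultimately show "g \<in> (\<Union>A\<in>\<A>'. cut A)" by blast
  qed
  hence "?P {g. \<not> has_giant H \<alpha> (\<lambda>e. f e \<or> g e)} \<le> ?P (\<Union>A\<in>\<A>'. cut A)"
    by (intro measure_pmf.finite_measure_mono) auto
  also have "\<dots> \<le> (\<Sum>A\<in>\<A>'. ?P (cut A))"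
    by (rule measure_pmf.finite_measure_subadditive_finite) (use fin\<A>' in auto)
  also have "\<dots> \<le> (\<Sum>A\<in>\<A>'. exp (- (q ^ L * (?c * ?n))))"
  proof (rule sum_mono)
    fix A assume A: "A \<in> \<A>'"
    hence AW: "A \<subseteq> W" "\<alpha> * ?n \<le> real (card A)" "\<alpha> * ?n \<le> real (card (W - A))"
      by (auto simp: \<A>'_def \<A>_def)
    have sub: "A \<subseteq> ?V" "W - A \<subseteq> ?V" "A \<inter> (W - A) = {}" using AW(1) WV by auto
    obtain \<F> where conn: "finite \<F> \<and> disjoint \<F> \<and>
      (\<forall>F\<in>\<F>. F \<subseteq> ?E \<and> card F \<le> L \<and> (\<exists>a\<in>A. \<exists>b\<in>W - A. b \<in> cluster F a)) \<and>
      ?c * ?n \<le> real (card \<F>)"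
      using many_disjoint_connections[OF H h \<alpha> sub(1) AW(2) sub(2) AW(3) sub(3) r] by (elim exE)
    note F = conn[THEN conjunct1] conn[THEN conjunct2, THEN conjunct1]
      conn[THEN conjunct2, THEN conjunct2, THEN conjunct1, THEN bspec]
      conn[THEN conjunct2, THEN conjunct2, THEN conjunct2]
    have "cut A \<subseteq> {g. \<forall>F\<in>\<F>. \<not> (\<forall>e\<in>F. g e)}"
    proof (intro subsetI CollectI ballI notI)
      fix g F assume g: "g \<in> cut A" and FF: "F \<in> \<F>" and o: "\<forall>e\<in>F. g e"
      have "\<exists>a\<in>A. \<exists>b\<in>W - A. b \<in> cluster F a" and FE: "F \<subseteq> ?E"
        using F(3)[OF FF] by simp_all
      then obtain a b where ab: "a \<in> A" "b \<in> W - A" "b \<in> cluster F a" by blast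
      let ?O = "{e\<in>?E. f e \<or> g e}"
      have "F \<subseteq> ?O" using FE o by auto
      from cluster_mono[OF this, of a] have "b \<in> cluster ?O a" using ab(3) by (rule subsetD)
      moreover have "b \<notin> cluster ?O a" using g ab(1,2) unfolding cut_def by simp
      ultimately show False by simp
    qed
    hence "?P (cut A) \<le> ?P {g. \<forall>F\<in>\<F>. \<not> (\<forall>e\<in>F. g e)}"
      by (intro measure_pmf.finite_measure_mono) auto
    also have "\<dots> \<le> (1 - q ^ L) ^ card \<F>"
      by (rule bond_perc_none_open_le[OF Hs(5) F(1,2) _ q]) (simp add: F(3))
    also have "\<dots> \<le> exp (- (q ^ L)) ^ card \<F>"
    proof (rule power_mono)
      show "1 - q ^ L \<le> exp (- (q ^ L))" using exp_ge_add_one_self[of "- (q ^ L)"] by simp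
      show "0 \<le> 1 - q ^ L" using q by (simp add: power_le_one)
    qed
    also have "\<dots> = exp (- (q ^ L * real (card \<F>)))"
      by (simp add: exp_of_nat_mult[symmetric] mult.commute)
    also have "\<dots> \<le> exp (- (q ^ L * (?c * ?n)))"
      using mult_left_mono[OF F(4), of "q ^ L"] q by simp
    finally show "?P (cut A) \<le> exp (- (q ^ L * (?c * ?n)))" .
  qed
  also have "\<dots> = real (card \<A>') * exp (- (q ^ L * (?c * ?n)))" by simp
  also have "\<dots> \<le> exp (?n / real k) * exp (- (q ^ L * (?c * ?n)))"
  proof (rule mult_right_mono)
    have "card \<A>' \<le> card \<A>" using fin\<A> by (intro card_mono) (auto simp: \<A>'_def)
    hence "real (card \<A>') \<le> real (2 ^ m)" using m(1) by linarith
    also have "\<dots> \<le> exp 1 ^ m" using exp_ge_add_one_self[of "1::real"] by (simp add: power_mono)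
    also have "\<dots> = exp (real m)" by (simp add: exp_of_nat_mult[symmetric])
    also have "real m \<le> ?n / real k"
      using m(2) k by (simp add: field_simps of_nat_mult[symmetric] del: of_nat_mult)
    hence "exp (real m) \<le> exp (?n / real k)" by simp
    finally show "real (card \<A>') \<le> exp (?n / real k)" by simp
  qed simp
  also have "\<dots> = exp (?n * (1 / real k - q ^ L * ?c))"
    by (simp add: exp_add[symmetric] algebra_simps)
  finally show ?thesis .
qed

text \<open>The first summand bounds the probability that the first percolation has too few vertices in big clusters,
  the second the probability that the sprinkling fails although it has enough.\<close>

lemma giant_after_sprinkling:
  assumes p: "0 \<le> p1" "p1 < p" "p \<le> 1" and k: "k > 0" and t: "t > 0"
    and mean: "3 * (\<alpha> * real (card (verts H))) + t \<le> (\<Sum>v\<in>verts H. theta (edges H) p1 k v)"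
    and r: "(1 + h / (2 * real (d + 1))) ^ r * \<alpha> > 1 / 2" "L \<ge> 2 * r" "L > 0"
  shows "1 - prob_large_component H p \<alpha>
    \<le> real (card (verts H)) * real ((d + 1) ^ (k + k)) / t\<^sup>2
      + exp (real (card (verts H)) * (1 / real k - ((p - p1) / (1 - p1)) ^ L * (h * \<alpha> / (2 * real L))))"
proof -
  let ?q = "(p - p1) / (1 - p1)" and ?E = "edges H" and ?n = "real (card (verts H))"
  let ?N = "\<lambda>f. real (card {v\<in>verts H. big {e\<in>?E. f e} k v})"
  note Hs = simple_of_finite[OF H] finite_verts[OF H] card_verts_pos[OF H] bounded_deg_of_degree_bound[OF H] finite_edges_of_finite[OF H]
  have q: "0 \<le> ?q" "?q \<le> 1" using p by auto
  have "1 - prob_large_component H p \<alpha> = measure_pmf.prob (bond_perc ?E p) {\<omega>. \<not> has_giant H \<alpha> \<omega>}"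
    unfolding prob_large_component_eq[OF H]
    using measure_pmf.prob_compl[of "{\<omega>. has_giant H \<alpha> \<omega>}" "bond_perc ?E p"]
    by (simp add: Compl_eq_Diff_UNIV[symmetric] Collect_neg_eq[symmetric])
  also have "\<dots> \<le> measure_pmf.prob (bond_perc ?E p1) {f. ?N f \<le> (\<Sum>v\<in>verts H. theta ?E p1 k v) - t}
      + exp (?n * (1 / real k - ?q ^ L * (h * \<alpha> / (2 * real L))))"
    unfolding bond_perc_sprinkle[OF Hs(5) p(1) _ less_imp_le[OF p(2)] p(3), OF less_le_trans[OF p(2,3)]]
  proof (rule prob_bind_le)
    fix f assume "\<not> ?N f \<le> (\<Sum>v\<in>verts H. theta ?E p1 k v) - t"
    hence "3 * (\<alpha> * ?n) \<le> ?N f" using mean by linarith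
    from sprinkling_fails[OF this k q r]
    show "measure_pmf.prob (map_pmf (\<lambda>g e. f e \<or> g e) (bond_perc ?E ?q)) {\<omega>. \<not> has_giant H \<alpha> \<omega>}
       \<le> exp (?n * (1 / real k - ?q ^ L * (h * \<alpha> / (2 * real L))))"
      by (simp add: vimage_def)
  qed simp
  also have "\<dots> \<le> ?n * real ((d + 1) ^ (k + k)) / t\<^sup>2 + exp (?n * (1 / real k - ?q ^ L * (h * \<alpha> / (2 * real L))))"
    by (intro add_right_mono big_vertices_lower_tail[OF H t])
  finally show ?thesis .
qed

end

section \<open>Passage to the weak limit\<close>

definition atypical :: "'b ugraph \<Rightarrow> 'a ugraph \<Rightarrow> 'a \<Rightarrow> nat \<Rightarrow> 'b set" where
  "atypical H G r R = {u\<in>verts H. \<not> rooted_iso (graph_ball H u R) u (graph_ball G r R) r}"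

lemma weak_convergence_atypical:
  assumes "weakly_converges Gs G r" "\<And>n. n \<ge> 1 \<Longrightarrow> finite_graph (Gs n)" "R > 0"
  shows "(\<lambda>n. real (card (atypical (Gs n) G r R)) / real (card (verts (Gs n)))) \<longlonglongrightarrow> 0"
proof -
  have "(\<lambda>n. \<P>(u in measure_pmf (pmf_of_set (verts (Gs n))).
      \<not> rooted_iso (graph_ball (Gs n) u R) u (graph_ball G r R) r)) \<longlonglongrightarrow> 0"
    using assms(1,3) unfolding weakly_converges_def by blast
  moreover have "\<P>(u in measure_pmf (pmf_of_set (verts (Gs n))).
      \<not> rooted_iso (graph_ball (Gs n) u R) u (graph_ball G r R) r)
      = real (card (atypical (Gs n) G r R)) / real (card (verts (Gs n)))" if "n \<ge> 1" for n
  proof -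
    have "verts (Gs n) \<noteq> {}" "finite (verts (Gs n))" using assms(2)[OF that] by (auto simp: finite_graph_def)
    thus ?thesis by (simp add: measure_pmf_of_set atypical_def Int_def)
  qed
  hence "eventually (\<lambda>n. \<P>(u in measure_pmf (pmf_of_set (verts (Gs n))).
      \<not> rooted_iso (graph_ball (Gs n) u R) u (graph_ball G r R) r)
      = real (card (atypical (Gs n) G r R)) / real (card (verts (Gs n)))) sequentially"
    using eventually_ge_at_top[of 1] by (rule eventually_mono[rotated])
  ultimately show ?thesis by (rule Lim_transform_eventually)
qed

text \<open>A typical vertex contributes exactly the value at the root of the limit, and an atypical one errs by at
  most \<open>1\<close> because probabilities lie in the unit interval.\<close>

lemma sum_theta_deviation:
  assumes H: "finite_graph H" "degree_bound H d" and G: "simple_graph G" "r \<in> verts G"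
  shows "\<bar>(\<Sum>v\<in>verts H. theta (edges H) p k v) - real (card (verts H)) * theta (edges G) p k r\<bar>
     \<le> real (card (atypical H G r k))"
proof -
  note Hs = simple_of_finite[OF H] finite_verts[OF H] bounded_deg_of_degree_bound[OF H]
  have "\<bar>(\<Sum>v\<in>verts H. theta (edges H) p k v) - real (card (verts H)) * theta (edges G) p k r\<bar>
     = \<bar>\<Sum>v\<in>verts H. theta (edges H) p k v - theta (edges G) p k r\<bar>"
    by (simp add: sum_subtractf)
  also have "\<dots> \<le> (\<Sum>v\<in>verts H. \<bar>theta (edges H) p k v - theta (edges G) p k r\<bar>)"
    by (rule sum_abs)
  also have "\<dots> \<le> (\<Sum>v\<in>verts H. indicator (atypical H G r k) v)"
  proof (rule sum_mono)
    fix v assume v: "v \<in> verts H"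
    show "\<bar>theta (edges H) p k v - theta (edges G) p k r\<bar> \<le> indicator (atypical H G r k) v"
    proof (cases "v \<in> atypical H G r k")
      case True
      thus ?thesis
        using theta_nonneg[of "edges H" p k v] theta_nonneg[of "edges G" p k r]
          theta_le_1[of "edges H" p k v] theta_le_1[of "edges G" p k r] by (simp add: abs_le_iff)
    next
      case False
      hence "rooted_iso (graph_ball H v k) v (graph_ball G r k) r" using v by (simp add: atypical_def)
      hence "theta (edges H) p k v = theta (edges G) p k r" by (rule theta_rooted_iso[OF Hs(1) v Hs(3) G])
      thus ?thesis by simp
    qed
  qed
  also have "\<dots> = real (card (atypical H G r k))"
    using Hs(2) by (simp add: indicator_def sum.If_cases atypical_def Int_def)
  finally show ?thesis .
qed

text \<open>The infinite graph has balls of radius \<open>R\<close> with at least \<open>R\<close> vertices, and a single typical vertex brings a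
  copy of such a ball into \<open>H\<close>. Hence the sizes of the approximating graphs tend to infinity.\<close>

lemma card_verts_ge_of_typical:
  assumes H: "finite_graph H" "degree_bound H d" and G: "simple_graph G" "bounded_deg (edges G) D" "r \<in> verts G"
    and inf: "infinite (cluster (edges G) r)"
    and frac: "real (card (atypical H G r R)) / real (card (verts H)) < 1"
  shows "R \<le> card (verts H)"
proof -
  note Hs = simple_of_finite[OF H] finite_verts[OF H] card_verts_pos[OF H]
  have "card (atypical H G r R) < card (verts H)" using frac Hs(3) by (simp add: field_simps)
  hence "atypical H G r R \<noteq> verts H" by auto
  then obtain u where u: "u \<in> verts H" "rooted_iso (graph_ball H u R) u (graph_ball G r R) r"
    by (auto simp: atypical_def)
  then obtain f where "bij_betw f (verts (graph_ball H u R)) (verts (graph_ball G r R))"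
    unfolding rooted_iso_def by blast
  hence "card (walk_ball (edges H) R u) = card (walk_ball (edges G) R r)"
    unfolding graph_ball_simps[OF Hs(1) u(1)] graph_ball_simps[OF G(1,3)] by (rule bij_betw_same_card)
  moreover have "R \<le> card (walk_ball (edges G) R r)"
    using big_iff_cluster[OF G(2), of R r] inf by (simp add: big_def)
  moreover have "card (walk_ball (edges H) R u) \<le> card (verts H)"
    using order_trans[OF walk_ball_subset_cluster simple_cluster_subset[OF Hs(1) u(1) order_refl]] Hs(2)
    by (intro card_mono)
  ultimately show ?thesis by simp
qed

context
  fixes G :: "'a ugraph" and \<rho> :: 'a and Gs :: "nat \<Rightarrow> 'b ugraph" and D d :: nat
  assumes G: "simple_graph G" "connected_graph G" "infinite (verts G)" "\<rho> \<in> verts G" "degree_bound G D"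
    and fin: "\<And>n. n \<ge> 1 \<Longrightarrow> finite_graph (Gs n)"
    and deg: "\<And>n. n \<ge> 1 \<Longrightarrow> degree_bound (Gs n) d"
    and conv: "weakly_converges Gs G \<rho>"
begin

lemma atypical_fraction:
  "R > 0 \<Longrightarrow> (\<lambda>n. real (card (atypical (Gs n) G \<rho> R)) / real (card (verts (Gs n)))) \<longlonglongrightarrow> 0"
  by (rule weak_convergence_atypical[OF conv]) (rule fin)

lemma eventually_atypical_le:
  assumes "R > 0" "\<epsilon> > 0"
  shows "eventually (\<lambda>n. real (card (atypical (Gs n) G \<rho> R)) \<le> \<epsilon> * real (card (verts (Gs n)))) sequentially"
  using order_tendstoD(2)[OF atypical_fraction[OF assms(1)] assms(2)] eventually_ge_at_top[of 1]
proof eventually_elim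
  case (elim n)
  thus ?case using card_verts_pos[OF fin[OF elim(2)] deg[OF elim(2)]] by (simp add: field_simps)
qed

lemma card_verts_at_top: "filterlim (\<lambda>n. real (card (verts (Gs n)))) at_top sequentially"
  unfolding filterlim_at_top
proof
  fix Z :: real
  define R where "R = nat \<lceil>max Z 1\<rceil>"
  have R: "R > 0" "Z \<le> real R" unfolding R_def by linarith+
  note Gd = bounded_deg_edges[OF G(1,5)]
  have inf: "infinite (cluster (edges G) \<rho>)"
    using connected_verts_eq_cluster[OF G(1) Gd G(2,4)] G(3) by simp
  show "eventually (\<lambda>n. Z \<le> real (card (verts (Gs n)))) sequentially"
    using order_tendstoD(2)[OF atypical_fraction[OF R(1)] zero_less_one] eventually_ge_at_top[of 1]
  proof eventually_elim
    case (elim n)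
    have "R \<le> card (verts (Gs n))"
      by (rule card_verts_ge_of_typical[OF fin deg G(1) Gd G(4) inf]) (use elim in auto)
    thus ?case using R(2) by linarith
  qed
qed

text \<open>First \<open>k\<close> is chosen so that the root of the limit rarely has a big cluster, then \<open>n\<close>.\<close>

lemma subcritical_no_giant:
  assumes p: "0 \<le> p" "p \<le> 1" "p < p_crit G" and \<alpha>: "\<alpha> > 0"
  shows "(\<lambda>n. prob_large_component (Gs n) p \<alpha>) \<longlonglongrightarrow> 0"
proof (rule order_tendstoI)
  fix a :: real assume "a < 0"
  moreover have "0 \<le> prob_large_component (Gs n) p \<alpha>" for n
    by (simp add: prob_large_component_def)
  ultimately show "eventually (\<lambda>n. a < prob_large_component (Gs n) p \<alpha>) sequentially"
    by (intro always_eventually allI) (rule less_le_trans)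
next
  fix \<epsilon> :: real assume \<epsilon>: "0 < \<epsilon>"
  have "(\<lambda>k. theta (edges G) p k \<rho>) \<longlonglongrightarrow> 0"
    by (rule theta_subcritical[OF G(1) bounded_deg_edges[OF G(1,5)] G(2,4) p])
  hence "eventually (\<lambda>k. theta (edges G) p k \<rho> < \<alpha> * \<epsilon> / 2) sequentially"
    using \<alpha> \<epsilon> by (intro order_tendstoD(2)) auto
  then obtain K where K: "\<forall>k\<ge>K. theta (edges G) p k \<rho> < \<alpha> * \<epsilon> / 2"
    unfolding eventually_sequentially by blast
  define k where "k = Suc K"
  have k: "k > 0" "theta (edges G) p k \<rho> < \<alpha> * \<epsilon> / 2" using K by (auto simp: k_def)
  have "eventually (\<lambda>n. real k / \<alpha> \<le> real (card (verts (Gs n)))) sequentially"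
    using card_verts_at_top unfolding filterlim_at_top by blast
  moreover have "eventually (\<lambda>n. real (card (atypical (Gs n) G \<rho> k)) \<le> \<alpha> * \<epsilon> / 2 * real (card (verts (Gs n)))) sequentially"
    using \<alpha> \<epsilon> by (intro eventually_atypical_le k(1)) auto
  ultimately show "eventually (\<lambda>n. prob_large_component (Gs n) p \<alpha> < \<epsilon>) sequentially"
    using eventually_ge_at_top[of 1]
  proof eventually_elim
    case (elim n)
    let ?n = "real (card (verts (Gs n)))"
    note H = fin[OF elim(3)] deg[OF elim(3)]
    have npos: "0 < ?n" using card_verts_pos[OF H] by simp
    have "prob_large_component (Gs n) p \<alpha> * (\<alpha> * ?n) \<le> (\<Sum>v\<in>verts (Gs n). theta (edges (Gs n)) p k v)"
      by (rule giant_markov[OF H \<alpha>]) (use elim(1) \<alpha> in \<open>simp add: field_simps\<close>)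
    also have "\<dots> \<le> ?n * theta (edges G) p k \<rho> + real (card (atypical (Gs n) G \<rho> k))"
      using sum_theta_deviation[OF H G(1,4), of p k] by linarith
    also have "\<dots> < ?n * (\<alpha> * \<epsilon> / 2) + \<alpha> * \<epsilon> / 2 * ?n"
      using elim(2) mult_strict_left_mono[OF k(2) npos] by linarith
    finally have "prob_large_component (Gs n) p \<alpha> * (\<alpha> * ?n) < \<epsilon> * (\<alpha> * ?n)" by (simp add: algebra_simps)
    thus ?case using \<alpha> npos by (simp add: mult_less_cancel_right)
  qed
qed

text \<open>The order of choices matters: \<open>\<alpha>\<close>, the path length \<open>L\<close> and the rate \<open>s\<close> depend on \<open>\<delta>\<close>, \<open>h\<close>, \<open>d\<close> and \<open>p\<close> only,
  and \<open>k\<close> is chosen afterwards, so that the entropy \<open>|G\<^sub>n|/k\<close> of the divisions loses against \<open>s |G\<^sub>n|\<close>.\<close>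

lemma supercritical_giant:
  assumes h: "h > 0" "\<And>n. n \<ge> 1 \<Longrightarrow> cheeger (Gs n) \<ge> ereal h"
    and p: "p_crit G < p" "p \<le> 1"
  shows "\<exists>\<alpha>>0. (\<lambda>n. prob_large_component (Gs n) p \<alpha>) \<longlonglongrightarrow> 1"
proof -
  obtain p1 \<delta> where p1: "0 < p1" "p1 < p" and \<delta>: "0 < \<delta>" "\<And>k. \<delta> \<le> theta (edges G) p1 k \<rho>"
    using theta_supercritical[OF G(1) bounded_deg_edges[OF G(1,5)] G(2-4) p] by blast
  (* Half of the expected \<delta>|G_n| vertices survive the lower tail bound, and a third of these is what
     each part of a division must contain. *)
  define \<alpha> where "\<alpha> = \<delta> / 6"
  have \<alpha>: "\<alpha> > 0" using \<delta>(1) by (simp add: \<alpha>_def)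
  define q where "q = (p - p1) / (1 - p1)"
  have q: "q > 0" using p1 p by (simp add: q_def)
  obtain r where "(1 + h / (2 * real (d + 1))) ^ r > 1 / (2 * \<alpha>)"
    using real_arch_pow[of "1 + h / (2 * real (d + 1))" "1 / (2 * \<alpha>)"] h(1) by auto
  hence r: "(1 + h / (2 * real (d + 1))) ^ r * \<alpha> > 1 / 2" using \<alpha> by (simp add: field_simps)
  (* The summand 1 keeps L positive if r = 0. *)
  define L where "L = 2 * r + 1"
  define s where "s = q ^ L * (h * \<alpha> / (2 * real L))"
  have s: "s > 0" using q h(1) \<alpha> by (simp add: s_def L_def)
  (* The rate s must beat 1 / k with room 1 / k to spare for exponential decay. *)
  obtain k where k: "k > 0" "2 / real k \<le> s"
  proof -
    obtain k where k: "2 / s < real k" using reals_Archimedean2 by blast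
    have "0 < 2 / s" using s by simp
    hence "real k > 0" using k by linarith
    moreover from this have "2 / real k \<le> s" using k s by (simp add: field_simps)
    ultimately have "real k > 0" "2 / real k \<le> s" .
    thus ?thesis by (intro that[of k]) auto
  qed
  let ?N = "\<lambda>n. real (card (verts (Gs n)))"
  define C where "C = real ((d + 1) ^ (k + k)) * 16 / \<delta>\<^sup>2"
  have "eventually (\<lambda>n. real (card (atypical (Gs n) G \<rho> k)) \<le> \<delta> / 4 * ?N n) sequentially"
    using \<delta>(1) by (intro eventually_atypical_le k(1)) auto
  hence bound: "eventually (\<lambda>n. 1 - prob_large_component (Gs n) p \<alpha> \<le> C / ?N n + exp (- (?N n / real k))) sequentially"
    using eventually_ge_at_top[of 1]
  proof eventually_elim
    case (elim n)
    note H = fin[OF elim(2)] deg[OF elim(2)]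
    have npos: "0 < ?N n" using card_verts_pos[OF H] by simp
    (* Between the expectation, at least 3/4 \<delta>|G_n|, and the target \<delta>|G_n|/2 there is this much room. *)
    define t where "t = \<delta> * ?N n / 4"
    have t: "t > 0" using \<delta>(1) npos by (simp add: t_def)
    have "?N n * \<delta> \<le> ?N n * theta (edges G) p1 k \<rho>" using \<delta>(2) by (intro mult_left_mono) auto
    hence "3 * (\<alpha> * ?N n) + t \<le> (\<Sum>v\<in>verts (Gs n). theta (edges (Gs n)) p1 k v)"
      using sum_theta_deviation[OF H G(1,4), of p1 k] elim(1) unfolding \<alpha>_def t_def
      by (simp add: algebra_simps)
    from giant_after_sprinkling[OF H h(1) h(2)[OF elim(2)] \<alpha> less_imp_le[OF p1(1)] p1(2) p(2) k(1) t this r, of L]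
    have "1 - prob_large_component (Gs n) p \<alpha> \<le> ?N n * real ((d + 1) ^ (k + k)) / t\<^sup>2 + exp (?N n * (1 / real k - s))"
      by (simp add: L_def s_def q_def)
    also have "?N n * real ((d + 1) ^ (k + k)) / t\<^sup>2 = C / ?N n"
      using npos \<delta>(1) by (simp add: t_def C_def power2_eq_square field_simps)
    also have "exp (?N n * (1 / real k - s)) \<le> exp (- (?N n / real k))"
    proof -
      have "1 / real k - s \<le> - (1 / real k)" using k(2) by simp
      from mult_left_mono[OF this less_imp_le[OF npos]] show ?thesis by simp
    qed
    finally show ?case by simp
  qed
  have "(\<lambda>n. C / ?N n) \<longlonglongrightarrow> 0"
    by (rule real_tendsto_divide_at_top[OF tendsto_const card_verts_at_top])
  moreover have "filterlim (\<lambda>n. ?N n / real k) at_top sequentially"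
    using k(1) filterlim_tendsto_pos_mult_at_top[OF tendsto_const[of "1 / real k"] _ card_verts_at_top] by simp
  hence "(\<lambda>n. exp (- (?N n / real k))) \<longlonglongrightarrow> 0"
    by (intro filterlim_compose[OF exp_at_bot]) (simp add: filterlim_uminus_at_bot)
  ultimately have "(\<lambda>n. C / ?N n + exp (- (?N n / real k))) \<longlonglongrightarrow> 0 + 0" by (rule tendsto_add)
  hence lim: "(\<lambda>n. C / ?N n + exp (- (?N n / real k))) \<longlonglongrightarrow> 0" by simp
  have "eventually (\<lambda>n. 0 \<le> 1 - prob_large_component (Gs n) p \<alpha>) sequentially"
    using eventually_ge_at_top[of 1]
  proof eventually_elim
    case (elim n)
    show ?case unfolding prob_large_component_eq[OF fin[OF elim] deg[OF elim]] by simp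
  qed
  from tendsto_sandwich[OF this bound tendsto_const lim]
  have "(\<lambda>n. 1 - (1 - prob_large_component (Gs n) p \<alpha>)) \<longlonglongrightarrow> 1 - 0"
    by (intro tendsto_diff tendsto_const)
  thus ?thesis using \<alpha> by auto
qed

end

theorem theorem1p3:
  fixes G :: "'a ugraph" and \<rho> :: 'a
    and Gs :: "nat \<Rightarrow> 'b ugraph"
    and h p :: real and d :: nat
  assumes "simple_graph G" and "connected_graph G" and "infinite (verts G)"
    and "\<rho> \<in> verts G"
    and "\<exists>D. degree_bound G D"
    and "\<And>n. n \<ge> 1 \<Longrightarrow> finite_graph (Gs n)"
    and "h > 0" and "\<And>n. n \<ge> 1 \<Longrightarrow> cheeger (Gs n) \<ge> ereal h"
    and "\<And>n. n \<ge> 1 \<Longrightarrow> degree_bound (Gs n) d"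
    and "weakly_converges Gs G \<rho>"
    and "0 \<le> p" and "p \<le> 1"
  shows "(p < p_crit G \<longrightarrow>
            (\<forall>\<alpha>>0. (\<lambda>n. prob_large_component (Gs n) p \<alpha>) \<longlonglongrightarrow> 0)) \<and>
         (p > p_crit G \<longrightarrow>
            (\<exists>\<alpha>>0. (\<lambda>n. prob_large_component (Gs n) p \<alpha>) \<longlonglongrightarrow> 1))"
proof -
  obtain D where D: "degree_bound G D" using assms(5) by blast
  note seq = assms(1-4) D assms(6,9,10)
  show ?thesis
    using subcritical_no_giant[OF seq assms(11,12)] supercritical_giant[OF seq assms(7,8) _ assms(12)]
    by blast
qed

end
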